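(* Given an input data stream $\sigma=(\sigma_1,\dots,\sigma_n)\in U^n$ of length $n$ and a similarity function $f:U\times U\to[0,1]$, for any $\epsilon\in(0,1)$, Algorithm A (the explicit three-pass procedure written out in the context) computes a $(1+\epsilon,o(1))$-approximation of the diversity index $\mathrm{DI}(\sigma)=\sum_{i\in[n]} d_i^{-1}$, using three passes and $O\left(\frac{1}{\epsilon^2}\sqrt{n}\log n\right)$ words of space.
   Context: Similarity graph. $U$ is a universe of items and $f:U\times U\to[0,1]$ is a symmetric similarity function with $f(x,x)=1$ for all $x\in U$. For a stream $\sigma=(\sigma_1,\dots,\sigma_n)\in U^n$, the similarity graph is the complete weighted graph (with self-loops) on node set $[n]=\{1,\dots,n\}$ with weights $w(i,j)=f(\sigma_i,\sigma_j)$. The degree of node $i$ is $d_i=\sum_{j\in[n]} f(\sigma_i,\sigma_j)$. Each stream position is a distinct node; node $i$ is represented by the pair $(i,\sigma_i)$. Node-arrival streaming model. The items $\sigma_1,\dots,\sigma_n$ arrive sequentially; a pass is one linear scan of the stream. Edge weights are not given; $f(x,y)$ is evaluated on demand, only when both items are in memory (the currently arriving item counts as being in memory). The length $n$ is known in advance. Space is measured in words in a unit-cost RAM model: each stream item, each value returned by $f$ and each arithmetic quantity maintained takes $O(1)$ words. Approximation. $\tilde X$ is a $(1+\epsilon,\delta)$-approximation of $X$ if $(1-\epsilon)X\le\tilde X\le(1+\epsilon)X$ with probability at least $1-\delta$. The $o(1)$ is as $n\to\infty$. Algorithm A (input: $\sigma$, $f$, $\epsilon$). All random choices are independent; $\log$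 is the natural logarithm; array sizes are rounded to integers. Set $t_1=\frac{48\sqrt n\log n}{\epsilon^2}$, $t_2=\frac{36\sqrt n\log n}{\epsilon^2}$, $\theta=\frac{96\log n}{\epsilon^2}$. Initialize $W_H=0$, $W_L=0$, $n_2=0$, an array $S_1$ of size $t_1$, and arrays $S_2$, $D$ of size $t_2$, all entries $0$. Pass 1: for each arriving $\sigma_j$ and each $i=1,\dots,t_1$, with probability $1/j$ set $S_1[i]\leftarrow\sigma_j$. Pass 2: for each arriving $\sigma_j$, compute $Y_j=\sum_{i\in[t_1]} f(S_1[i],\sigma_j)$. If $Y_j\ge\theta$, set $W_H\leftarrow W_H+\left(\frac{n}{t_1}Y_j\right)^{-1}$. Otherwise set $n_2\leftarrow n_2+1$ and, for each $i=1,\dots,t_2$, with probability $1/n_2$ set $S_2[i]\leftarrow\sigma_j$. Pass 3: for each arriving $\sigma_j$ and each $i=1,\dots,t_2$, set $D[i]\leftarrow D[i]+f(S_2[i],\sigma_j)$. After Pass 3, set $W_L=\frac{n_2}{t_2}\sum_{i\in[t_2]}\frac{1}{D[i]}$ (with $W_L=0$ if $n_2=0$) and return $W_H+W_L$. *)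

theory Defs
  imports "HOL-Probability.Probability"
begin

subsection \<open>Similarity graph of a stream\<close>

definition similarity :: "('u \<Rightarrow> 'u \<Rightarrow> real) \<Rightarrow> bool" where
  "similarity f \<longleftrightarrow>
     (\<forall>x y. 0 \<le> f x y \<and> f x y \<le> 1) \<and> (\<forall>x y. f x y = f y x) \<and> (\<forall>x. f x x = 1)"

text \<open>Nodes are stream positions, here counted from 0.\<close>

definition weight :: "('u \<Rightarrow> 'u \<Rightarrow> real) \<Rightarrow> 'u list \<Rightarrow> nat \<Rightarrow> nat \<Rightarrow> real" where
  "weight f \<sigma> i j = f (\<sigma> ! i) (\<sigma> ! j)"

definition degree :: "('u \<Rightarrow> 'u \<Rightarrow> real) \<Rightarrow> 'u list \<Rightarrow> nat \<Rightarrow> real" where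
  "degree f \<sigma> i = (\<Sum>j<length \<sigma>. weight f \<sigma> i j)"

definition diversity_index :: "('u \<Rightarrow> 'u \<Rightarrow> real) \<Rightarrow> 'u list \<Rightarrow> real" where
  "diversity_index f \<sigma> = (\<Sum>i<length \<sigma>. inverse (degree f \<sigma> i))"

definition approximates :: "real \<Rightarrow> real \<Rightarrow> real pmf \<Rightarrow> real \<Rightarrow> bool" where
  "approximates \<epsilon> \<delta> p X \<longleftrightarrow>
     measure_pmf.prob p {x. (1 - \<epsilon>) * X \<le> x \<and> x \<le> (1 + \<epsilon>) * X} \<ge> 1 - \<delta>"

subsection \<open>Node-arrival streaming programs\<close>

text \<open>
  Programs act on a store of unit-cost words, each holding a stream item or a number.
  The store is their only state. A program text contains neither items nor the similarity
  function: items enter the store only by arriving in a scan and move only by \<open>Copy\<close>, and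
  the similarity function is reached only through \<open>Query\<close>, whose arguments are cells of
  the store.

  A cell is an array name with an index; a scalar is the cell with index 0. Cells that have
  not been written read as the number 0.
\<close>

datatype 'u word = Num real | Item 'u

type_synonym ('v, 'u) store = "'v \<times> nat \<Rightarrow> 'u word option"

definition look :: "('v, 'u) store \<Rightarrow> 'v \<times> nat \<Rightarrow> 'u word" where
  "look s l = (case s l of None \<Rightarrow> Num 0 | Some w \<Rightarrow> w)"

fun num :: "'u word \<Rightarrow> real" where
  "num (Num r) = r"
| "num (Item x) = 0"

text \<open>The value at a non-item is a dummy; it arises only for a sample array that is
  still blank because nothing has been sampled.\<close>

fun sim :: "('u \<Rightarrow> 'u \<Rightarrow> real) \<Rightarrow> 'u word \<Rightarrow> 'u word \<Rightarrow> real" where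
  "sim f (Item x) (Item y) = f x y"
| "sim f _ _ = 0"

datatype 'v exp =
    Const real
  | Load 'v "'v exp"
  | Add "'v exp" "'v exp"  (infixl "\<oplus>" 65)
  | Mul "'v exp" "'v exp"  (infixl "\<otimes>" 70)
  | Quot "'v exp" "'v exp"  (infixl "\<oslash>" 70)
  | Sqrt "'v exp"
  | Ln "'v exp"
  | Ceil "'v exp"

abbreviation Var :: "'v \<Rightarrow> 'v exp" where
  "Var x \<equiv> Load x (Const 0)"

primrec eval :: "('v, 'u) store \<Rightarrow> 'v exp \<Rightarrow> real" where
  "eval s (Const r) = r"
| "eval s (Load x e) = num (look s (x, nat \<lfloor>eval s e\<rfloor>))"
| "eval s (e1 \<oplus> e2) = eval s e1 + eval s e2"
| "eval s (e1 \<otimes> e2) = eval s e1 * eval s e2"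
| "eval s (e1 \<oslash> e2) = eval s e1 / eval s e2"
| "eval s (Sqrt e) = sqrt (eval s e)"
| "eval s (Ln e) = ln (eval s e)"
| "eval s (Ceil e) = of_int \<lceil>eval s e\<rceil>"

type_synonym 'v loc = "'v \<times> 'v exp"

abbreviation scalar :: "'v \<Rightarrow> 'v loc" where
  "scalar x \<equiv> (x, Const 0)"

definition addr :: "('v, 'u) store \<Rightarrow> 'v loc \<Rightarrow> 'v \<times> nat" where
  "addr s l = (fst l, nat \<lfloor>eval s (snd l)\<rfloor>)"

text \<open>\<open>IfLe e1 e2 c1 c2\<close> branches on \<open>e1 \<le> e2\<close>; \<open>For i e c\<close> runs \<open>c\<close> with the scalar \<open>i\<close>
  set to \<open>1, ..., e\<close> in turn; \<open>WithProb e c\<close> tosses a fresh coin and runs \<open>c\<close> with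
  probability \<open>e\<close>.\<close>

datatype 'v com =
    Assign "'v loc" "'v exp"  (infix "::=" 61)
  | Copy "'v loc" "'v loc"
  | Query "'v loc" "'v loc" "'v loc"
  | Seq "'v com" "'v com"  (infixr ";;" 60)
  | IfLe "'v exp" "'v exp" "'v com" "'v com"
  | For 'v "'v exp" "'v com"
  | WithProb "'v exp" "'v com"

primrec run_seq :: "('a \<Rightarrow> 's \<Rightarrow> 's pmf) \<Rightarrow> 'a list \<Rightarrow> 's \<Rightarrow> 's pmf" where
  "run_seq g [] s = return_pmf s"
| "run_seq g (x # xs) s = bind_pmf (g x s) (run_seq g xs)"

primrec exec :: "('u \<Rightarrow> 'u \<Rightarrow> real) \<Rightarrow> 'v com \<Rightarrow> ('v, 'u) store \<Rightarrow> ('v, 'u) store pmf" where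
  "exec f (l ::= e) = (\<lambda>s. return_pmf (s(addr s l \<mapsto> Num (eval s e))))"
| "exec f (Copy l l1) = (\<lambda>s. return_pmf (s(addr s l \<mapsto> look s (addr s l1))))"
| "exec f (Query l l1 l2) =
     (\<lambda>s. return_pmf (s(addr s l \<mapsto> Num (sim f (look s (addr s l1)) (look s (addr s l2))))))"
| "exec f (c1 ;; c2) = (\<lambda>s. bind_pmf (exec f c1 s) (exec f c2))"
| "exec f (IfLe e1 e2 c1 c2) = (\<lambda>s. if eval s e1 \<le> eval s e2 then exec f c1 s else exec f c2 s)"
| "exec f (For i e c) =
     (\<lambda>s. run_seq (\<lambda>k t. exec f c (t((i, 0) \<mapsto> Num (real k)))) [1..<Suc (nat \<lfloor>eval s e\<rfloor>)] s)"
| "exec f (WithProb e c) =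
     (\<lambda>s. bind_pmf (bernoulli_pmf (eval s e)) (\<lambda>b. if b then exec f c s else return_pmf s))"

text \<open>\<open>Scan x c\<close> is one pass: each arriving item is put into the scalar \<open>x\<close> and processed
  by \<open>c\<close>. \<open>Local c\<close> runs \<open>c\<close> once, without access to the stream.\<close>

datatype 'v phase = Local "'v com" | is_scan: Scan 'v "'v com"

fun exec_phase ::
  "('u \<Rightarrow> 'u \<Rightarrow> real) \<Rightarrow> 'u list \<Rightarrow> 'v phase \<Rightarrow> ('v, 'u) store \<Rightarrow> ('v, 'u) store pmf" where
  "exec_phase f \<sigma> (Local c) = exec f c"
| "exec_phase f \<sigma> (Scan x c) = run_seq (\<lambda>u s. exec f c (s((x, 0) \<mapsto> Item u))) \<sigma>"

type_synonym 'v program = "'v phase list"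

definition passes :: "'v program \<Rightarrow> nat" where
  "passes P = length (filter is_scan P)"

definition run ::
  "('u \<Rightarrow> 'u \<Rightarrow> real) \<Rightarrow> 'u list \<Rightarrow> 'v program \<Rightarrow> ('v, 'u) store \<Rightarrow> ('v, 'u) store pmf" where
  "run f \<sigma> P s = run_seq (exec_phase f \<sigma>) P s"

text \<open>No command releases a cell, so the cells occupied at the end of a run are all the cells
  occupied at any time during it; their number is the peak space, up to the words needed to
  evaluate expressions and to keep loop bounds, whose number depends only on the program
  text.\<close>

lemma dom_upd_subset: "dom s \<subseteq> dom (s(l \<mapsto> w))"
  by auto

lemma run_seq_dom_mono:
  assumes "\<And>x s s'. s' \<in> set_pmf (g x s) \<Longrightarrow> dom s \<subseteq> dom s'"
  shows "s' \<in> set_pmf (run_seq g xs s) \<Longrightarrow> dom s \<subseteq> dom s'"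
proof (induction xs arbitrary: s)
  case Nil
  then show ?case by simp
next
  case (Cons x xs)
  then obtain t where "t \<in> set_pmf (g x s)" "s' \<in> set_pmf (run_seq g xs t)"
    by auto
  with Cons.IH assms show ?case by (meson order_trans)
qed

lemma exec_dom_mono: "s' \<in> set_pmf (exec f c s) \<Longrightarrow> dom s \<subseteq> dom s'"
proof (induction c arbitrary: s s')
  case (Seq c1 c2)
  then show ?case by (force simp: set_bind_pmf)
next
  case (IfLe e1 e2 c1 c2)
  then show ?case by (auto split: if_splits)
next
  case (For i e c)
  have "dom s \<subseteq> dom s'"
    if "s' \<in> set_pmf (exec f c (s((i, 0) \<mapsto> Num (real k))))" for k s s'
    using For.IH[OF that] by (meson dom_upd_subset order_trans)
  from run_seq_dom_mono[where g = "\<lambda>k t. exec f c (t((i, 0) \<mapsto> Num (real k)))", OF this]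
    For.prems
  show ?case by (simp only: exec.simps)
next
  case (WithProb e c)
  from WithProb.prems show ?case
    by (auto simp del: set_pmf_bernoulli split: if_splits dest: WithProb.IH)
qed auto

lemma run_dom_mono: "s' \<in> set_pmf (run f \<sigma> P s) \<Longrightarrow> dom s \<subseteq> dom s'"
proof -
  have scan: "dom s \<subseteq> dom s'"
    if "s' \<in> set_pmf (exec f c (s((x, 0) \<mapsto> Item u)))" for x c u s s'
    using exec_dom_mono[OF that] by (meson dom_upd_subset order_trans)
  have phase: "dom s \<subseteq> dom s'" if "s' \<in> set_pmf (exec_phase f \<sigma> p s)" for p s s'
  proof (cases p)
    case (Local c)
    with that show ?thesis by (simp add: exec_dom_mono)
  next
    case (Scan x c)
    with that show ?thesis
      using run_seq_dom_mono[where g = "\<lambda>u s. exec f c (s((x, 0) \<mapsto> Item u))", OF scan] by simp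
  qed
  assume "s' \<in> set_pmf (run f \<sigma> P s)"
  then show "dom s \<subseteq> dom s'"
    unfolding run_def by (rule run_seq_dom_mono[rotated]) (rule phase)
qed

definition space_at_most :: "('v, 'u) store pmf \<Rightarrow> real \<Rightarrow> bool" where
  "space_at_most p B \<longleftrightarrow> (\<forall>s\<in>set_pmf p. finite (dom s) \<and> real (card (dom s)) \<le> B)"

subsection \<open>The three-pass algorithm\<close>

text \<open>\<open>N\<close> and \<open>Eps\<close> hold the input parameters, \<open>X\<close> the arriving item, \<open>I\<close> and \<open>J\<close> are counters
  and \<open>Q\<close> receives query results.\<close>

datatype reg =
  N | Eps | T1 | T2 | Theta | WH | WL | N2 | S1 | S2 | D | X | I | J | Y | Q | Out

definition initialize :: "reg com" where
  "initialize =
     (scalar T1 ::= Ceil (Const 48 \<otimes> Sqrt (Var N) \<otimes> Ln (Var N) \<oslash> (Var Eps \<otimes> Var Eps))) ;;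
     (scalar T2 ::= Ceil (Const 36 \<otimes> Sqrt (Var N) \<otimes> Ln (Var N) \<oslash> (Var Eps \<otimes> Var Eps))) ;;
     (scalar Theta ::= Const 96 \<otimes> Ln (Var N) \<oslash> (Var Eps \<otimes> Var Eps)) ;;
     (scalar WH ::= Const 0) ;;
     (scalar WL ::= Const 0) ;;
     (scalar N2 ::= Const 0) ;;
     For I (Var T1) ((S1, Var I) ::= Const 0) ;;
     For I (Var T2) ((S2, Var I) ::= Const 0 ;; (D, Var I) ::= Const 0) ;;
     (scalar J ::= Const 0)"

definition pass1 :: "reg com" where
  "pass1 =
     (scalar J ::= Var J \<oplus> Const 1) ;;
     For I (Var T1) (WithProb (Const 1 \<oslash> Var J) (Copy (S1, Var I) (scalar X)))"

definition pass2 :: "reg com" where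
  "pass2 =
     (scalar Y ::= Const 0) ;;
     For I (Var T1)
       (Query (scalar Q) (S1, Var I) (scalar X) ;;
        (scalar Y ::= Var Y \<oplus> Var Q)) ;;
     IfLe (Var Theta) (Var Y)
       (scalar WH ::= Var WH \<oplus> Const 1 \<oslash> (Var N \<oslash> Var T1 \<otimes> Var Y))
       ((scalar N2 ::= Var N2 \<oplus> Const 1) ;;
        For I (Var T2) (WithProb (Const 1 \<oslash> Var N2) (Copy (S2, Var I) (scalar X))))"

definition pass3 :: "reg com" where
  "pass3 =
     For I (Var T2)
       (Query (scalar Q) (S2, Var I) (scalar X) ;;
        ((D, Var I) ::= Load D (Var I) \<oplus> Var Q))"

definition finish :: "reg com" where
  "finish =
     (scalar WL ::= Const 0) ;;
     IfLe (Var N2) (Const 0)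
       (scalar WL ::= Const 0)
       (For I (Var T2) (scalar WL ::= Var WL \<oplus> Const 1 \<oslash> Load D (Var I)) ;;
        (scalar WL ::= Var N2 \<oslash> Var T2 \<otimes> Var WL)) ;;
     (scalar Out ::= Var WH \<oplus> Var WL)"

definition algorithm_A :: "reg program" where
  "algorithm_A = [Local initialize, Scan X pass1, Scan X pass2, Scan X pass3, Local finish]"

definition run_A :: "('u \<Rightarrow> 'u \<Rightarrow> real) \<Rightarrow> 'u list \<Rightarrow> real \<Rightarrow> (reg, 'u) store pmf" where
  "run_A f \<sigma> \<epsilon> =
     run f \<sigma> algorithm_A [(N, 0) \<mapsto> Num (real (length \<sigma>)), (Eps, 0) \<mapsto> Num \<epsilon>]"

definition output_A :: "('u \<Rightarrow> 'u \<Rightarrow> real) \<Rightarrow> 'u list \<Rightarrow> real \<Rightarrow> real pmf" where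
  "output_A f \<sigma> \<epsilon> = map_pmf (\<lambda>s. num (look s (Out, 0))) (run_A f \<sigma> \<epsilon>)"

end

theory Submission
  imports Defs
begin

text \<open>
  The run is coupled, pass by pass, with independent samples: reservoir sampling makes the cells
  of \<open>S1\<close> independent uniform draws from \<open>\<sigma>\<close>, and, given \<open>S1\<close>, the cells of \<open>S2\<close> independent
  uniform draws from the sublist of light items, those whose score \<open>Y\<close> stays below \<open>\<theta>\<close>.

  Chernoff bounds then split the nodes at degree \<open>sqrt n\<close>. Scores of nodes of larger degree have
  mean at least \<open>48 ln n / \<epsilon>\<^sup>2\<close> and hence, simultaneously for all of them, relative error at
  most \<open>\<epsilon> / 2\<close>; nodes of smaller degree are all light. So every light node has degree at most
  \<open>4 sqrt n\<close>, the average of \<open>1 / d\<close> over the light nodes is at least \<open>1 / (4 sqrt n)\<close>, and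
  \<open>36 sqrt n ln n / \<epsilon>\<^sup>2\<close> draws estimate that average with relative error \<open>\<epsilon>\<close>. The failure
  probability is at most \<open>4 / n\<^sup>2\<close>.
\<close>

subsection \<open>Sequential composition\<close>

lemma run_seq_Nil: "run_seq g [] = return_pmf"
  by (rule ext) simp

lemma run_seq_append: "run_seq g (xs @ ys) s = bind_pmf (run_seq g xs s) (run_seq g ys)"
  by (induction xs arbitrary: s) (auto simp: bind_assoc_pmf bind_return_pmf intro!: bind_pmf_cong)

lemma run_seq_snoc: "run_seq g (xs @ [x]) s = bind_pmf (run_seq g xs s) (g x)"
proof -
  have "run_seq g [x] = g x"
    by (rule ext) (simp add: run_seq_Nil bind_return_pmf')
  then show ?thesis by (simp only: run_seq_append)
qed

lemma run_seq_for_invariant: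
  assumes "s' \<in> set_pmf (run_seq g [1..<Suc t] s)" "P 0 s"
    and "\<And>k s s'. k < t \<Longrightarrow> P k s \<Longrightarrow> s' \<in> set_pmf (g (Suc k) s) \<Longrightarrow> P (Suc k) s'"
  shows "P t s'"
  using assms
proof (induction t arbitrary: s')
  case (Suc t)
  have "[1..<Suc (Suc t)] = [1..<Suc t] @ [Suc t]" by simp
  with Suc.prems obtain r where r: "r \<in> set_pmf (run_seq g [1..<Suc t] s)" "s' \<in> set_pmf (g (Suc t) r)"
    by (auto simp: run_seq_snoc simp del: upt_Suc)
  from Suc.IH[OF r(1)] Suc.prems have "P t r" by auto
  with r Suc.prems show ?case by blast
qed simp

subsection \<open>Sampling with replacement in a stream\<close>

text \<open>For the empty list the value is the content of a blank cell, so the law of a sample cell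
  is also correct before anything has been sampled. The multiset counts repeated items with
  multiplicity, since nodes are positions.\<close>

definition draw :: "'u list \<Rightarrow> 'u word pmf" where
  "draw xs = (if xs = [] then return_pmf (Num 0) else pmf_of_multiset (image_mset Item (mset xs)))"

definition replace_prob :: "real \<Rightarrow> 'a \<Rightarrow> 'a \<Rightarrow> 'a pmf" where
  "replace_prob p x v = map_pmf (\<lambda>b. if b then x else v) (bernoulli_pmf p)"

lemma set_pmf_draw: "set_pmf (draw xs) = (if xs = [] then {Num 0} else Item ` set xs)"
  by (simp add: draw_def)

text \<open>A draw is the image of a uniform position in the list, which turns the expectation into
  an average along the list.\<close>

lemma expectation_draw:
  assumes "xs \<noteq> []"
  shows "measure_pmf.expectation (draw xs) h = (\<Sum>x\<leftarrow>xs. h (Item x)) / real (length xs)"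
proof -
  let ?I = "{..<length xs}"
  have "image_mset (\<lambda>k. Item (xs ! k)) (mset_set ?I) = mset (map Item (map ((!) xs) [0..<length xs]))"
    by (simp add: mset_upt lessThan_atLeast0 image_mset.compositionality o_def)
  also have "\<dots> = image_mset Item (mset xs)"
    by (simp only: map_nth mset_map)
  finally have "draw xs = map_pmf (\<lambda>k. Item (xs ! k)) (pmf_of_set ?I)"
    using assms by (subst map_pmf_of_set) (auto simp: draw_def lessThan_empty_iff)
  then show ?thesis
    using assms by (simp add: integral_pmf_of_set lessThan_empty_iff sum_list_sum_nth lessThan_atLeast0)
qed

text \<open>The reservoir step: after k earlier items the new one is taken with probability 1/(k +
  1), and each old position keeps probability 1/k * k/(k + 1).\<close>

lemma draw_snoc: "draw (xs @ [x]) = bind_pmf (draw xs) (replace_prob (1 / real (Suc (length xs))) (Item x))"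
proof (cases "xs = []")
  case True
  \<comment> \<open>The first item replaces the blank content with probability 1.\<close>
  have "bernoulli_pmf 1 = return_pmf True"
    by (intro pmf_eqI) (auto simp: indicator_def split: bool.split)
  with True show ?thesis
    by (auto simp: draw_def replace_prob_def bind_return_pmf intro!: pmf_eqI split: split_indicator)
next
  case False
  let ?k = "real (length xs)"
  have "pmf (draw (xs @ [x])) w = pmf (bind_pmf (draw xs) (replace_prob (1 / real (Suc (length xs))) (Item x))) w" for w
  proof -
    \<comment> \<open>Tossing the coin before the old draw exhibits the result as a mixture of two
      laws.\<close>
    have "bind_pmf (draw xs) (replace_prob (1 / real (Suc (length xs))) (Item x)) =
        bind_pmf (bernoulli_pmf (1 / real (Suc (length xs)))) (\<lambda>b. if b then return_pmf (Item x) else draw xs)"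
      unfolding replace_prob_def map_pmf_def
      by (subst bind_commute_pmf) (auto intro!: bind_pmf_cong simp: bind_return_pmf')
    then have "pmf (bind_pmf (draw xs) (replace_prob (1 / real (Suc (length xs))) (Item x))) w =
        pmf (return_pmf (Item x)) w * (1 / (?k + 1)) + pmf (draw xs) w * (1 - 1 / (?k + 1))"
      by (simp add: pmf_bind add.commute)
    also have "1 - 1 / (?k + 1) = ?k / (?k + 1)"
      by (simp add: field_simps)
    finally show ?thesis
      using False by (simp add: draw_def add_divide_distrib add.commute split: split_indicator)
  qed
  then show ?thesis by (rule pmf_eqI)
qed

text \<open>A kernel that reads and rewrites a single coordinate preserves independence, because its
  step commutes with the draw of all other coordinates.\<close>

lemma Pi_pmf_update:
  assumes "finite A" "k \<in> A"
  shows "bind_pmf (Pi_pmf A d q) (\<lambda>g. map_pmf (\<lambda>v. g(k := v)) (h (g k))) =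
    Pi_pmf A d (q(k := bind_pmf (q k) h))"
proof -
  define B where "B = A - {k}"
  have B: "A = insert k B" "finite B" "k \<notin> B" using assms by (auto simp: B_def)
  have 1: "Pi_pmf B d (q(k := bind_pmf (q k) h)) = Pi_pmf B d q"
    using B by (intro Pi_pmf_cong) auto
  show ?thesis
    unfolding B(1)
    apply (simp only: Pi_pmf_insert'[OF B(2,3)] 1)
    apply (simp add: bind_assoc_pmf bind_return_pmf map_pmf_def)
    apply (rule bind_pmf_cong[OF refl])
    apply (subst bind_commute_pmf)
    apply simp
    done
qed

text \<open>This treats the inner loop over the sample cells as a simultaneous update of independent
  coordinates.\<close>

lemma Pi_pmf_update_all:
  "bind_pmf (Pi_pmf {1..t} d (\<lambda>_. q))
     (run_seq (\<lambda>i g. map_pmf (\<lambda>v. g(i := v)) (h (g i))) [1..<Suc t]) =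
   Pi_pmf {1..t} d (\<lambda>_. bind_pmf q h)"
proof -
  let ?r = "run_seq (\<lambda>i g. map_pmf (\<lambda>v. g(i := v)) (h (g i)))"
  \<comment> \<open>Hybrid law after m iterations: the first m coordinates follow the new law, the
    others still the old one.\<close>
  have "bind_pmf (Pi_pmf {1..t} d (\<lambda>_. q)) (?r [1..<Suc m]) =
      Pi_pmf {1..t} d (\<lambda>i. if i \<le> m then bind_pmf q h else q)" if "m \<le> t" for m
    using that
  proof (induction m)
    case 0
    show ?case by (simp add: bind_return_pmf') (rule Pi_pmf_cong, auto)
  next
    case (Suc m)
    have eq: "[1..<Suc (Suc m)] = [1..<Suc m] @ [Suc m]" by simp
    have "bind_pmf (Pi_pmf {1..t} d (\<lambda>_. q)) (?r [1..<Suc (Suc m)]) =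
       bind_pmf (Pi_pmf {1..t} d (\<lambda>i. if i \<le> m then bind_pmf q h else q))
         (\<lambda>g. map_pmf (\<lambda>v. g(Suc m := v)) (h (g (Suc m))))"
      unfolding eq run_seq_snoc 
      using Suc by (simp only: bind_assoc_pmf[symmetric] Suc_leD)
    also have "\<dots> = Pi_pmf {1..t} d (\<lambda>i. if i \<le> Suc m then bind_pmf q h else q)"
      using Suc.prems by (subst Pi_pmf_update) (auto intro!: Pi_pmf_cong)
    finally show ?case .
  qed
  then have "bind_pmf (Pi_pmf {1..t} d (\<lambda>_. q)) (?r [1..<Suc t]) =
      Pi_pmf {1..t} d (\<lambda>i. if i \<le> t then bind_pmf q h else q)" by blast
  also have "\<dots> = Pi_pmf {1..t} d (\<lambda>_. bind_pmf q h)"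
    by (intro Pi_pmf_cong) auto
  finally show ?thesis .
qed

text \<open>Integrate the pointwise bound \<open>indicator (- G) x + b\<close>: outside the good
  event the inner probability is at most 1, inside it is at most \<open>b\<close>. This separates
  the failures of the two sampling stages.\<close>

lemma prob_bind_le:
  assumes "measure_pmf.prob p (- G) \<le> a"
    and "\<And>x. x \<in> set_pmf p \<Longrightarrow> x \<in> G \<Longrightarrow> measure_pmf.prob (f x) B \<le> b" and "0 \<le> b"
  shows "measure_pmf.prob (bind_pmf p f) B \<le> a + b"
proof -
  have int: "integrable (measure_pmf p) (\<lambda>x. h x)" if "\<And>x. \<bar>h x\<bar> \<le> c" for h :: "'a \<Rightarrow> real" and c
    using that by (intro measure_pmf.integrable_const_bound[where B = c]) auto
  have "ennreal (measure_pmf.prob (bind_pmf p f) B) = (\<integral>\<^sup>+x. ennreal (measure_pmf.prob (f x) B) \<partial>p)"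
    by (simp add: measure_pmf.emeasure_eq_measure[symmetric])
  also have "\<dots> \<le> (\<integral>\<^sup>+x. ennreal (indicator (- G) x + b) \<partial>p)"
  proof (intro nn_integral_mono_AE AE_pmfI ennreal_leI)
    fix x assume "x \<in> set_pmf p"
    with assms(2)[of x] show "measure_pmf.prob (f x) B \<le> indicator (- G) x + b"
      using measure_pmf.prob_le_1[of "f x" B] \<open>0 \<le> b\<close> by (auto split: split_indicator intro: order_trans)
  qed
  also have "\<dots> = ennreal (measure_pmf.prob p (- G) + b)"
    using \<open>0 \<le> b\<close>
    by (subst nn_integral_eq_integral)
      (auto intro!: int[of _ "1 + b"] arg_cong[of _ _ ennreal] simp: Bochner_Integration.integral_add int[of _ 1] split: split_indicator)
  finally have "measure_pmf.prob (bind_pmf p f) B \<le> measure_pmf.prob p (- G) + b"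
    using \<open>0 \<le> b\<close> by (subst (asm) ennreal_le_iff) (auto simp del: ennreal_plus)
  with assms(1) show ?thesis by linarith
qed

subsection \<open>Chernoff bounds\<close>

lemma exp_le_quadratic:
  fixes s :: real
  assumes "\<bar>s\<bar> \<le> 1"
  shows "exp s \<le> 1 + s + s\<^sup>2"
proof (cases "0 \<le> s")
  case True
  with assms show ?thesis by (intro exp_bound) auto
next
  case False
  define r where "r = - s"
  have r: "0 < r" "r \<le> 1" "s = - r" using False assms by (auto simp: r_def)
  \<comment> \<open>The product equals \<open>1 + r ^ 3\<close>.\<close>
  have "1 \<le> (1 - r + r\<^sup>2) * (1 + r)"
    using r by (auto simp: algebra_simps power2_eq_square)
  also have "\<dots> \<le> (1 - r + r\<^sup>2) * exp r"
    using r by (intro mult_left_mono exp_ge_add_one_self) auto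
  finally show ?thesis using r by (simp add: exp_minus field_simps)
qed

text \<open>Independence turns the expectation of the product into a power, and each factor is
  bounded through the mean of \<open>h\<close> alone. Both signs of \<open>s\<close> are covered at
  once.\<close>

lemma mgf_Pi_pmf_le:
  fixes h :: "'a \<Rightarrow> real"
  assumes h: "\<And>v. v \<in> set_pmf q \<Longrightarrow> 0 \<le> h v \<and> h v \<le> 1" and s: "\<bar>s\<bar> \<le> 1"
  shows "measure_pmf.expectation (Pi_pmf {1..t::nat} d (\<lambda>_. q)) (\<lambda>g. exp (s * (\<Sum>i=1..t. h (g i))))
    \<le> exp (real t * measure_pmf.expectation q h * (s + s\<^sup>2))"
proof -
  let ?m = "measure_pmf.expectation q h"
  have ih: "integrable (measure_pmf q) h"
    using h by (intro measure_pmf.integrable_const_bound[where B = 1]) (auto intro!: AE_pmfI)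
  have ie: "integrable (measure_pmf q) (\<lambda>v. exp (s * h v))"
  proof (intro measure_pmf.integrable_const_bound[where B = "exp 1"] AE_pmfI)
    fix v assume "v \<in> set_pmf q"
    then have "\<bar>s * h v\<bar> \<le> 1 * 1" unfolding abs_mult using h s by (intro mult_mono) auto
    then show "norm (exp (s * h v)) \<le> exp 1" by simp
  qed simp
  \<comment> \<open>The exponential lies below its chord between 0 and \<open>s\<close>.\<close>
  have convex: "exp (s * x) \<le> 1 + x * (exp s - 1)" if "0 \<le> x" "x \<le> 1" for x
    using convex_onD[OF exp_convex, of x 0 s] that by (auto simp: algebra_simps)
  have m0: "0 \<le> ?m" using h by (intro integral_nonneg_AE AE_pmfI) auto
  have "measure_pmf.expectation q (\<lambda>v. exp (s * h v)) \<le> measure_pmf.expectation q (\<lambda>v. 1 + h v * (exp s - 1))"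
    using ih ie h convex by (intro integral_mono_AE AE_pmfI) auto
  also have "\<dots> = 1 + ?m * (exp s - 1)" using ih by simp
  also have "\<dots> \<le> 1 + ?m * (s + s\<^sup>2)"
    using exp_le_quadratic[OF s] m0 by (intro add_left_mono mult_left_mono) auto
  also have "\<dots> \<le> exp (?m * (s + s\<^sup>2))" by (rule exp_ge_add_one_self)
  finally have one: "measure_pmf.expectation q (\<lambda>v. exp (s * h v)) \<le> exp (?m * (s + s\<^sup>2))" .
  have "measure_pmf.expectation (Pi_pmf {1..t} d (\<lambda>_. q)) (\<lambda>g. exp (s * (\<Sum>i=1..t. h (g i)))) =
      measure_pmf.expectation (Pi_pmf {1..t} d (\<lambda>_. q)) (\<lambda>g. \<Prod>i=1..t. exp (s * h (g i)))"
    by (simp add: sum_distrib_left exp_sum)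
  also have "\<dots> = measure_pmf.expectation q (\<lambda>v. exp (s * h v)) ^ t"
    using ie by (subst expectation_prod_Pi_pmf) auto
  also have "\<dots> \<le> exp (?m * (s + s\<^sup>2)) ^ t"
    using one by (intro power_mono) (auto intro: integral_nonneg_AE)
  finally show ?thesis by (simp add: exp_of_nat_mult[symmetric] mult.assoc)
qed

text \<open>Markov's inequality for the exponential moment. The factor \<open>s\<close> stays on
  both sides of the event, so that a positive \<open>s\<close> gives the upper tail and a negative
  one the lower tail.\<close>

lemma tail_Pi_pmf_le:
  fixes h :: "'a \<Rightarrow> real"
  assumes h: "\<And>v. v \<in> set_pmf q \<Longrightarrow> 0 \<le> h v \<and> h v \<le> 1" and s: "\<bar>s\<bar> \<le> 1"
  shows "measure_pmf.prob (Pi_pmf {1..t::nat} d (\<lambda>_. q)) {g. s * c \<le> s * (\<Sum>i=1..t. h (g i))}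
    \<le> exp (real t * measure_pmf.expectation q h * (s + s\<^sup>2) - s * c)"
proof -
  let ?P = "Pi_pmf {1..t} d (\<lambda>_. q)"
  have int: "integrable (measure_pmf ?P) (\<lambda>g. exp (s * (\<Sum>i=1..t. h (g i))))"
  proof (intro measure_pmf.integrable_const_bound[where B = "exp (real t)"] AE_pmfI)
    fix g assume "g \<in> set_pmf ?P"
    then have g: "g i \<in> set_pmf q" if "i \<in> {1..t}" for i
      using that by (auto simp: set_Pi_pmf PiE_dflt_def)
    have "\<bar>\<Sum>i=1..t. h (g i)\<bar> \<le> (\<Sum>i=1..t. 1)"
      using h[OF g] by (intro order_trans[OF sum_abs] sum_mono) (simp add: abs_of_nonneg)
    then have "\<bar>s * (\<Sum>i=1..t. h (g i))\<bar> \<le> 1 * real t"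
      unfolding abs_mult using s by (intro mult_mono) auto
    then show "norm (exp (s * (\<Sum>i=1..t. h (g i)))) \<le> exp (real t)" by simp
  qed simp
  have "measure_pmf.prob ?P {g. s * c \<le> s * (\<Sum>i=1..t. h (g i))} =
      measure_pmf.prob ?P {g \<in> space (measure_pmf ?P). exp (s * c) \<le> exp (s * (\<Sum>i=1..t. h (g i)))}"
    by simp
  also have "\<dots> \<le> measure_pmf.expectation ?P (\<lambda>g. exp (s * (\<Sum>i=1..t. h (g i)))) / exp (s * c)"
    using int by (intro integral_Markov_inequality_measure[where A = "{}"]) auto
  also have "\<dots> \<le> exp (real t * measure_pmf.expectation q h * (s + s\<^sup>2)) / exp (s * c)"
    using mgf_Pi_pmf_le[OF h s] by (intro divide_right_mono) auto
  finally show ?thesis by (simp add: exp_diff)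
qed

lemma chernoff_Pi_pmf:
  fixes h :: "'a \<Rightarrow> real" and t :: nat
  assumes h: "\<And>v. v \<in> set_pmf q \<Longrightarrow> 0 \<le> h v \<and> h v \<le> 1" and \<eta>: "0 \<le> \<eta>" "\<eta> \<le> 1"
  defines "m \<equiv> real t * measure_pmf.expectation q h"
  shows "measure_pmf.prob (Pi_pmf {1..t} d (\<lambda>_. q)) {g. \<eta> * m < \<bar>(\<Sum>i=1..t. h (g i)) - m\<bar>}
    \<le> 2 * exp (- (\<eta>\<^sup>2 * m / 4))"
proof -
  let ?P = "measure_pmf.prob (Pi_pmf {1..t} d (\<lambda>_. q))"
  let ?S = "\<lambda>g. \<Sum>i=1..t. h (g i)"
  \<comment> \<open>The parameters \<eta>/2 and -\<eta>/2 minimise the exponents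
    \<open>m * (s\<^sup>2 - s * \<eta>)\<close> and \<open>m * (s\<^sup>2 + s * \<eta>)\<close> of
    the two tails.\<close>
  let ?U = "{g. (\<eta>/2) * ((1 + \<eta>) * m) \<le> (\<eta>/2) * ?S g}"
  let ?L = "{g. (-\<eta>/2) * ((1 - \<eta>) * m) \<le> (-\<eta>/2) * ?S g}"
  have "{g. \<eta> * m < \<bar>?S g - m\<bar>} \<subseteq> ?U \<union> ?L"
  proof
    fix g assume "g \<in> {g. \<eta> * m < \<bar>?S g - m\<bar>}"
    then have "(1 + \<eta>) * m \<le> ?S g \<or> ?S g \<le> (1 - \<eta>) * m"
      by (auto simp: algebra_simps abs_if split: if_splits)
    then show "g \<in> ?U \<union> ?L"
      using \<eta> mult_left_mono[of "(1 + \<eta>) * m" "?S g" "\<eta>/2"] mult_left_mono[of "?S g" "(1 - \<eta>) * m" "\<eta>/2"] by auto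
  qed
  then have "?P {g. \<eta> * m < \<bar>?S g - m\<bar>} \<le> ?P ?U + ?P ?L"
    by (intro order_trans[OF measure_pmf.finite_measure_mono measure_Un_le]) auto
  also have "?P ?U \<le> exp (m * (\<eta>/2 + (\<eta>/2)\<^sup>2) - (\<eta>/2) * ((1 + \<eta>) * m))"
    unfolding m_def using \<eta> by (intro tail_Pi_pmf_le h) auto
  also have "m * (\<eta>/2 + (\<eta>/2)\<^sup>2) - (\<eta>/2) * ((1 + \<eta>) * m) = - (\<eta>\<^sup>2 * m / 4)"
    by (simp add: field_simps power2_eq_square)
  also have "?P ?L \<le> exp (m * (-\<eta>/2 + (-\<eta>/2)\<^sup>2) - (-\<eta>/2) * ((1 - \<eta>) * m))"
    unfolding m_def using \<eta> by (intro tail_Pi_pmf_le h) auto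
  also have "m * (-\<eta>/2 + (-\<eta>/2)\<^sup>2) - (-\<eta>/2) * ((1 - \<eta>) * m) = - (\<eta>\<^sup>2 * m / 4)"
    by (simp add: field_simps power2_eq_square)
  finally show ?thesis by simp
qed

subsection \<open>Execution of the algorithm\<close>

lemma look_upd [simp]: "look (s(l \<mapsto> w)) l' = (if l' = l then w else look s l')"
  by (simp add: look_def)

lemma nat_one_plus_int [simp]: "nat (1 + int k) = Suc k"
  by simp

text \<open>An upper bound for the set of occupied cells: index 0 of every register and the array
  cells, which start at index 1.\<close>

definition cells :: "nat \<Rightarrow> nat \<Rightarrow> (reg \<times> nat) set" where
  "cells t1 t2 = UNIV \<times> {0} \<union> {S1} \<times> {1..t1} \<union> {S2, D} \<times> {1..t2}"

lemma UNIV_reg: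
  "(UNIV :: reg set) = set [N, Eps, T1, T2, Theta, WH, WL, N2, S1, S2, D, X, I, J, Y, Q, Out]"
proof -
  have "r \<in> set [N, Eps, T1, T2, Theta, WH, WL, N2, S1, S2, D, X, I, J, Y, Q, Out]" for r
    by (cases r) auto
  then show ?thesis by blast
qed

lemma finite_cells: "finite (cells t1 t2)"
  unfolding cells_def UNIV_reg by auto

lemma card_cells: "card (cells t1 t2) \<le> 17 + t1 + 2 * t2"
proof -
  have "card ((UNIV :: reg set) \<times> {0::nat}) \<le> 17"
    unfolding UNIV_reg card_cartesian_product by (rule order_trans[OF mult_le_mono1[OF card_length]]) simp
  moreover have "card (({S2, D} :: reg set) \<times> {1..t2}) = 2 * t2"
    by (simp add: card_cartesian_product)
  moreover have "card (({S1} :: reg set) \<times> {1..t1}) = t1"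
    by (simp add: card_cartesian_product)
  ultimately show ?thesis
    unfolding cells_def
    by (intro order_trans[OF card_Un_le] order_trans[OF add_mono[OF card_Un_le order_refl]]) simp
qed

section \<open>Couplings and invariants of loops\<close>

lemma run_seq_Cons: "run_seq g (x # xs) = (\<lambda>s. bind_pmf (g x s) (run_seq g xs))"
  by (rule ext) simp

text \<open>\<open>rel_pmf R\<close> provides a coupling supported on \<open>R\<close>; couplings of
  the single steps compose along the list. Stores are related in this way to idealised sample
  vectors.\<close>

lemma rel_run_seq:
  assumes "R s a" and "\<And>x s a. x \<in> set xs \<Longrightarrow> R s a \<Longrightarrow> rel_pmf R (g x s) (h x a)"
  shows "rel_pmf R (run_seq g xs s) (run_seq h xs a)"
  using assms
proof (induction xs arbitrary: s a)
  case (Cons x xs)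
  have "rel_pmf R (g x s) (h x a)" using Cons.prems by simp
  then show ?case
    unfolding run_seq.simps by (rule rel_pmf_bindI) (rule Cons.IH, auto intro: Cons.prems)
qed simp

text \<open>\<open>P k\<close> describes the store after k iterations, hence the counter value
  \<open>Suc k\<close> in the step. The loop bound is evaluated once, in the initial store.\<close>

lemma exec_For_invariant:
  assumes "s' \<in> set_pmf (exec f (For i e c) s)" "nat \<lfloor>eval s e\<rfloor> = t" "P 0 s"
    and "\<And>k s s'. k < t \<Longrightarrow> P k s \<Longrightarrow> s' \<in> set_pmf (exec f c (s((i, 0) \<mapsto> Num (real (Suc k))))) \<Longrightarrow> P (Suc k) s'"
  shows "P t s'"
proof (rule run_seq_for_invariant[where g = "\<lambda>k t. exec f c (t((i, 0) \<mapsto> Num (real k)))" and s = s])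
  show "s' \<in> set_pmf (run_seq (\<lambda>k t. exec f c (t((i, 0) \<mapsto> Num (real k)))) [1..<Suc t] s)"
    using assms(1,2) by (simp del: upt_Suc)
qed (use assms(3,4) in blast)+

text \<open>The sampling loop shared by passes 1 and 2, with \<open>V\<close> the counter of the
  items eligible so far. Besides the coupling it records which cells may change, so that the
  invariants of the surrounding pass survive.\<close>

lemma rel_sample_loop:
  fixes A V T :: reg
  assumes "V \<noteq> I" "T \<noteq> I"
    and s: "look s (T, 0) = Num (real t)" "look s (X, 0) = w" "look s (V, 0) = Num v"
      "\<forall>i\<in>{1..t}. look s (A, i) = g i"
  shows "rel_pmf (\<lambda>s' g'. (\<forall>i\<in>{1..t}. look s' (A, i) = g' i) \<and>
        (\<forall>l. l \<notin> insert (I, 0) ({A} \<times> {1..t}) \<longrightarrow> look s' l = look s l) \<and>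
        dom s' \<subseteq> dom s \<union> insert (I, 0) ({A} \<times> {1..t}))
      (exec f (For I (Var T) (WithProb (Const 1 \<oslash> Var V) (Copy (A, Var I) (scalar X)))) s)
      (run_seq (\<lambda>i g. map_pmf (\<lambda>b. g(i := b)) (replace_prob (1 / v) w (g i))) [1..<Suc t] g)"
    (is "rel_pmf ?R _ _")
proof -
  let ?c = "WithProb (Const 1 \<oslash> Var V) (Copy (A, Var I) (scalar X))"
  have "rel_pmf ?R (run_seq (\<lambda>k t. exec f ?c (t((I, 0) \<mapsto> Num (real k)))) [1..<Suc t] s)
      (run_seq (\<lambda>i g. map_pmf (\<lambda>b. g(i := b)) (replace_prob (1 / v) w (g i))) [1..<Suc t] g)"
  proof (rule rel_run_seq)
    show "?R s g" using s by auto
  next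
    fix k s' g' assume k: "k \<in> set [1..<Suc t]" and R: "?R s' g'"
    from R have look': "l \<notin> insert (I, 0) ({A} \<times> {1..t}) \<Longrightarrow> look s' l = look s l" for l by blast
    have V: "look s' (V, 0) = Num v" and X: "look s' (X, 0) = w"
      using s assms(1) by (subst look'; simp)+
    \<comment> \<open>Both sides toss the same coin.\<close>
    have "rel_pmf ?R
       (bind_pmf (bernoulli_pmf (1 / v)) (\<lambda>b. if b then exec f (Copy (A, Var I) (scalar X)) (s'((I, 0) \<mapsto> Num (real k)))
           else return_pmf (s'((I, 0) \<mapsto> Num (real k)))))
       (bind_pmf (bernoulli_pmf (1 / v)) (\<lambda>b. return_pmf (g'(k := if b then w else g' k))))"
    proof (rule rel_pmf_bindI[where R = "(=)"])
      fix b b' :: bool assume "b = b'"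
      with k R X show "rel_pmf ?R (if b then exec f (Copy (A, Var I) (scalar X)) (s'((I, 0) \<mapsto> Num (real k)))
           else return_pmf (s'((I, 0) \<mapsto> Num (real k))))
         (return_pmf (g'(k := if b' then w else g' k)))"
        by (auto simp: addr_def)
    qed (simp add: pmf.rel_eq)
    then show "rel_pmf ?R (exec f ?c (s'((I, 0) \<mapsto> Num (real k))))
       (map_pmf (\<lambda>b. g'(k := b)) (replace_prob (1 / v) w (g' k)))"
      using V \<open>V \<noteq> I\<close> by (simp add: replace_prob_def map_pmf_comp map_pmf_def bind_assoc_pmf bind_return_pmf)
  qed
  then show ?thesis using s by (simp del: upt_Suc)
qed

section \<open>Idealised quantities and the store invariants of the passes\<close>

locale sampling =
  fixes f :: "'u \<Rightarrow> 'u \<Rightarrow> real" and n \<theta> :: real and t1 t2 :: nat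
begin

definition score :: "(nat \<Rightarrow> 'u word) \<Rightarrow> 'u \<Rightarrow> real" where
  "score g x = (\<Sum>i=1..t1. sim f (g i) (Item x))"

definition heavy_sum :: "(nat \<Rightarrow> 'u word) \<Rightarrow> 'u list \<Rightarrow> real" where
  "heavy_sum g xs = (\<Sum>x\<leftarrow>filter (\<lambda>x. \<theta> \<le> score g x) xs. 1 / (n / real t1 * score g x))"

definition light :: "(nat \<Rightarrow> 'u word) \<Rightarrow> 'u list \<Rightarrow> 'u list" where
  "light g xs = filter (\<lambda>x. \<not> \<theta> \<le> score g x) xs"

text \<open>The argument is a word, so the same function gives the degree of an item and the value
  accumulated in a cell of \<open>D\<close>.\<close>

definition sim_sum :: "'u list \<Rightarrow> 'u word \<Rightarrow> real" where
  "sim_sum xs w = (\<Sum>x\<leftarrow>xs. sim f w (Item x))"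

text \<open>The summands are the final \<open>WH\<close> and \<open>WL\<close>. If there are no
  light items, the factor 0 yields the prescribed \<open>WL = 0\<close>.\<close>

definition estimate :: "'u list \<Rightarrow> (nat \<Rightarrow> 'u word) \<Rightarrow> (nat \<Rightarrow> 'u word) \<Rightarrow> real" where
  "estimate xs g h = heavy_sum g xs +
     real (length (light g xs)) / real t2 * (\<Sum>i=1..t2. 1 / sim_sum xs (h i))"

definition sample1 :: "'u list \<Rightarrow> (nat \<Rightarrow> 'u word) pmf" where
  "sample1 xs = Pi_pmf {1..t1} (Num 0) (\<lambda>_. draw xs)"

definition sample2 :: "'u list \<Rightarrow> (nat \<Rightarrow> 'u word) pmf" where
  "sample2 xs = Pi_pmf {1..t2} (Num 0) (\<lambda>_. draw xs)"

text \<open>The space bound is part of the invariant, so a single coupling yields both the output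
  law and the space claim.\<close>

definition conf :: "(reg, 'u) store \<Rightarrow> bool" where
  "conf s \<longleftrightarrow> dom s \<subseteq> cells t1 t2 \<and> look s (N, 0) = Num n \<and> look s (T1, 0) = Num (real t1) \<and>
     look s (T2, 0) = Num (real t2) \<and> look s (Theta, 0) = Num \<theta>"

text \<open>Initial values that pass 1 leaves intact for the later passes.\<close>

definition fresh :: "(reg, 'u) store \<Rightarrow> bool" where
  "fresh s \<longleftrightarrow> look s (WH, 0) = Num 0 \<and> look s (N2, 0) = Num 0 \<and>
     (\<forall>i\<in>{1..t2}. look s (S2, i) = Num 0 \<and> look s (D, i) = Num 0)"

definition inv1 :: "nat \<Rightarrow> (reg, 'u) store \<Rightarrow> (nat \<Rightarrow> 'u word) \<Rightarrow> bool" where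
  "inv1 j s g \<longleftrightarrow> conf s \<and> fresh s \<and> look s (J, 0) = Num (real j) \<and> (\<forall>i\<in>{1..t1}. look s (S1, i) = g i)"

definition inv2 :: "(nat \<Rightarrow> 'u word) \<Rightarrow> 'u list \<Rightarrow> (reg, 'u) store \<Rightarrow> (nat \<Rightarrow> 'u word) \<Rightarrow> bool" where
  "inv2 g xs s h \<longleftrightarrow> conf s \<and> (\<forall>i\<in>{1..t1}. look s (S1, i) = g i) \<and>
     look s (WH, 0) = Num (heavy_sum g xs) \<and> look s (N2, 0) = Num (real (length (light g xs))) \<and>
     (\<forall>i\<in>{1..t2}. look s (S2, i) = h i \<and> look s (D, i) = Num 0)"

text \<open>Pass 3 tosses no coins, so an invariant of the reachable stores, with the sample
  \<open>h\<close> as a parameter, replaces the coupling.\<close>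

definition inv3 :: "real \<Rightarrow> nat \<Rightarrow> (nat \<Rightarrow> 'u word) \<Rightarrow> 'u list \<Rightarrow> (reg, 'u) store \<Rightarrow> bool" where
  "inv3 a m h xs s \<longleftrightarrow> conf s \<and> look s (WH, 0) = Num a \<and> look s (N2, 0) = Num (real m) \<and>
     (\<forall>i\<in>{1..t2}. look s (S2, i) = h i \<and> look s (D, i) = Num (sim_sum xs (h i)))"

text \<open>The hypotheses repeat the program expressions, with \<open>e * e\<close> because the
  language only has products, and say that the rounded sizes are natural numbers.\<close>

lemma initialize:
  assumes "s' \<in> set_pmf (exec f initialize [(N, 0) \<mapsto> Num n, (Eps, 0) \<mapsto> Num e])"
    and t1: "of_int \<lceil>48 * sqrt n * ln n / (e * e)\<rceil> = real t1"
    and t2: "of_int \<lceil>36 * sqrt n * ln n / (e * e)\<rceil> = real t2"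
    and \<theta>: "96 * ln n / (e * e) = \<theta>"
  shows "inv1 0 s' (\<lambda>_. Num 0)"
proof -
  let ?c1 = "For I (Var T1) ((S1, Var I) ::= Const 0)"
  let ?c2 = "For I (Var T2) ((S2, Var I) ::= Const 0 ;; (D, Var I) ::= Const 0)"
  define base :: "(reg, 'u) store \<Rightarrow> bool" where
    "base s \<longleftrightarrow> conf s \<and> look s (WH, 0) = Num 0 \<and> look s (N2, 0) = Num 0" for s
  obtain s0 s1 s2 where s0: "base s0" and s1: "s1 \<in> set_pmf (exec f ?c1 s0)"
    and s2: "s2 \<in> set_pmf (exec f ?c2 s1)" and s': "s' = s2((J, 0) \<mapsto> Num 0)"
  proof -
    define s0 where "s0 = ([(N, 0) \<mapsto> Num n, (Eps, 0) \<mapsto> Num e, (T1, 0) \<mapsto> Num (real t1),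
      (T2, 0) \<mapsto> Num (real t2), (Theta, 0) \<mapsto> Num \<theta>, (WH, 0) \<mapsto> Num 0, (WL, 0) \<mapsto> Num 0,
      (N2, 0) \<mapsto> Num 0] :: (reg, 'u) store)"
    have "base s0"
      by (auto simp: base_def conf_def s0_def cells_def)
    moreover have "exec f initialize [(N, 0) \<mapsto> Num n, (Eps, 0) \<mapsto> Num e] =
        bind_pmf (exec f ?c1 s0) (\<lambda>s. bind_pmf (exec f ?c2 s) (\<lambda>s. return_pmf (s((J, 0) \<mapsto> Num 0))))"
      unfolding initialize_def s0_def
      by (simp add: bind_return_pmf addr_def t1 t2 \<theta> del: exec.simps(6))
    ultimately show thesis using assms(1) that by auto
  qed
  have "base s1 \<and> (\<forall>i\<in>{1..t1}. look s1 (S1, i) = Num 0)"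
  proof (rule exec_For_invariant[OF s1, where P = "\<lambda>k s. base s \<and> (\<forall>i\<in>{1..k}. look s (S1, i) = Num 0)"])
    show "nat \<lfloor>eval s0 (Var T1)\<rfloor> = t1" using s0 by (simp add: base_def conf_def)
    fix k and s s' :: "(reg, 'u) store"
    assume "k < t1" "base s \<and> (\<forall>i\<in>{1..k}. look s (S1, i) = Num 0)"
      "s' \<in> set_pmf (exec f ((S1, Var I) ::= Const 0) (s((I, 0) \<mapsto> Num (real (Suc k)))))"
    then show "base s' \<and> (\<forall>i\<in>{1..Suc k}. look s' (S1, i) = Num 0)"
      by (auto simp: base_def conf_def addr_def cells_def)
  qed (use s0 in auto)
  note s1' = this
  have "base s2 \<and> (\<forall>i\<in>{1..t1}. look s2 (S1, i) = Num 0) \<and> (\<forall>i\<in>{1..t2}. look s2 (S2, i) = Num 0 \<and> look s2 (D, i) = Num 0)"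
  proof (rule exec_For_invariant[OF s2, where P = "\<lambda>k s. base s \<and> (\<forall>i\<in>{1..t1}. look s (S1, i) = Num 0) \<and>
         (\<forall>i\<in>{1..k}. look s (S2, i) = Num 0 \<and> look s (D, i) = Num 0)"])
    show "nat \<lfloor>eval s1 (Var T2)\<rfloor> = t2" using s1' by (simp add: base_def conf_def)
    fix k and s s' :: "(reg, 'u) store"
    assume "k < t2" "base s \<and> (\<forall>i\<in>{1..t1}. look s (S1, i) = Num 0) \<and>
         (\<forall>i\<in>{1..k}. look s (S2, i) = Num 0 \<and> look s (D, i) = Num 0)"
      "s' \<in> set_pmf (exec f ((S2, Var I) ::= Const 0 ;; (D, Var I) ::= Const 0) (s((I, 0) \<mapsto> Num (real (Suc k)))))"
    then show "base s' \<and> (\<forall>i\<in>{1..t1}. look s' (S1, i) = Num 0) \<and>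
         (\<forall>i\<in>{1..Suc k}. look s' (S2, i) = Num 0 \<and> look s' (D, i) = Num 0)"
      by (auto simp: base_def conf_def addr_def cells_def bind_return_pmf)
  qed (use s1' in auto)
  then show ?thesis
    by (auto simp: s' inv1_def base_def conf_def fresh_def cells_def)
qed

text \<open>Induction on the prefix read so far: one arrival is the sampling loop, which updates all
  independent coordinates by the reservoir step.\<close>

lemma rel_pass1:
  assumes "inv1 0 s (\<lambda>_. Num 0)"
  shows "rel_pmf (inv1 (length xs)) (exec_phase f xs (Scan X pass1) s) (sample1 xs)"
proof (induction xs rule: rev_induct)
  case Nil
  with assms show ?case by (simp add: sample1_def draw_def)
next
  case (snoc x xs)
  let ?p = "1 / real (Suc (length xs))"
  let ?L = "run_seq (\<lambda>i g. map_pmf (\<lambda>b. g(i := b)) (replace_prob ?p (Item x) (g i))) [1..<Suc t1]"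
  have "rel_pmf (inv1 (length (xs @ [x])))
      (bind_pmf (exec_phase f xs (Scan X pass1) s) (\<lambda>s. exec f pass1 (s((X, 0) \<mapsto> Item x))))
      (bind_pmf (sample1 xs) ?L)"
  proof (rule rel_pmf_bindI[OF snoc.IH])
    fix s g assume inv: "inv1 (length xs) s g"
    \<comment> \<open>\<open>J\<close> is incremented before the coins are tossed, so the arrival
      after \<open>xs\<close> uses the denominator \<open>Suc (length xs)\<close>.\<close>
    define s1 where "s1 = s((X, 0) \<mapsto> Item x, (J, 0) \<mapsto> Num (real (Suc (length xs))))"
    have "exec f pass1 (s((X, 0) \<mapsto> Item x)) =
        exec f (For I (Var T1) (WithProb (Const 1 \<oslash> Var J) (Copy (S1, Var I) (scalar X)))) s1"
      using inv unfolding pass1_def s1_def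
      by (simp add: bind_return_pmf addr_def inv1_def add.commute del: exec.simps(6))
    moreover have "rel_pmf (inv1 (length (xs @ [x])))
        (exec f (For I (Var T1) (WithProb (Const 1 \<oslash> Var J) (Copy (S1, Var I) (scalar X)))) s1) (?L g)"
    proof (rule pmf.rel_mono_strong[OF rel_sample_loop])
      show "look s1 (T1, 0) = Num (real t1)" "look s1 (X, 0) = Item x"
        "look s1 (J, 0) = Num (real (Suc (length xs)))" "\<forall>i\<in>{1..t1}. look s1 (S1, i) = g i"
        using inv by (auto simp: s1_def inv1_def conf_def)
      fix s' g' assume *: "(\<forall>i\<in>{1..t1}. look s' (S1, i) = g' i) \<and>
        (\<forall>l. l \<notin> insert (I, 0) ({S1} \<times> {1..t1}) \<longrightarrow> look s' l = look s1 l) \<and>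
        dom s' \<subseteq> dom s1 \<union> insert (I, 0) ({S1} \<times> {1..t1})"
      have "dom s1 \<union> insert (I, 0) ({S1} \<times> {1..t1}) \<subseteq> cells t1 t2"
        using inv by (auto simp: s1_def inv1_def conf_def cells_def)
      with * have "dom s' \<subseteq> cells t1 t2" by blast
      moreover from * have "l \<notin> insert (I, 0) ({S1} \<times> {1..t1}) \<Longrightarrow> look s' l = look s1 l" for l by blast
      ultimately show "inv1 (length (xs @ [x])) s' g'"
        using inv * by (simp add: inv1_def conf_def fresh_def s1_def)
    qed simp_all
    ultimately show "rel_pmf (inv1 (length (xs @ [x]))) (exec f pass1 (s((X, 0) \<mapsto> Item x))) (?L g)" by simp
  qed
  moreover have "bind_pmf (sample1 xs) ?L = sample1 (xs @ [x])"
    unfolding sample1_def draw_snoc by (rule Pi_pmf_update_all)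
  ultimately show ?case by (simp add: run_seq_snoc del: upt_Suc)
qed

lemma rel_pass2_step:
  assumes inv: "inv2 g xs s h"
  shows "rel_pmf (inv2 g (xs @ [x])) (exec f pass2 (s((X, 0) \<mapsto> Item x)))
    (if \<theta> \<le> score g x then return_pmf h
     else run_seq (\<lambda>i h. map_pmf (\<lambda>b. h(i := b)) (replace_prob (1 / real (Suc (length (light g xs)))) (Item x) (h i))) [1..<Suc t2] h)"
    (is "rel_pmf _ _ ?A")
proof -
  let ?loop = "For I (Var T1) (Query (scalar Q) (S1, Var I) (scalar X) ;; (scalar Y ::= Var Y \<oplus> Var Q))"
  let ?heavy = "scalar WH ::= Var WH \<oplus> Const 1 \<oslash> (Var N \<oslash> Var T1 \<otimes> Var Y)"
  let ?sample = "For I (Var T2) (WithProb (Const 1 \<oslash> Var N2) (Copy (S2, Var I) (scalar X)))"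
  let ?light = "(scalar N2 ::= Var N2 \<oplus> Const 1) ;; ?sample"
  let ?post = "\<lambda>s1. inv2 g xs s1 h \<and> look s1 (X, 0) = Item x \<and> look s1 (Y, 0) = Num (score g x)"
  have "exec f pass2 (s((X, 0) \<mapsto> Item x)) =
      bind_pmf (exec f ?loop (s((X, 0) \<mapsto> Item x, (Y, 0) \<mapsto> Num 0))) (exec f (IfLe (Var Theta) (Var Y) ?heavy ?light))"
    unfolding pass2_def by (simp add: bind_return_pmf addr_def del: exec.simps(6))
  moreover have "rel_pmf (inv2 g (xs @ [x]))
      (bind_pmf (exec f ?loop (s((X, 0) \<mapsto> Item x, (Y, 0) \<mapsto> Num 0))) (exec f (IfLe (Var Theta) (Var Y) ?heavy ?light)))
      (bind_pmf (return_pmf ()) (\<lambda>_. ?A))"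
  proof (rule rel_pmf_bindI)
    \<comment> \<open>The scoring loop tosses no coins. Paired with a point mass, it only has to
      establish \<open>?post\<close> on its support.\<close>
    show "rel_pmf (\<lambda>s1 _. ?post s1) (exec f ?loop (s((X, 0) \<mapsto> Item x, (Y, 0) \<mapsto> Num 0))) (return_pmf ())"
      unfolding rel_pmf_return_pmf2
    proof
      fix s1 assume s1: "s1 \<in> set_pmf (exec f ?loop (s((X, 0) \<mapsto> Item x, (Y, 0) \<mapsto> Num 0)))"
      have "inv2 g xs s1 h \<and> look s1 (X, 0) = Item x \<and> look s1 (Y, 0) = Num (\<Sum>i=1..t1. sim f (g i) (Item x))"
      proof (rule exec_For_invariant[OF s1, where P = "\<lambda>k s1. inv2 g xs s1 h \<and> look s1 (X, 0) = Item x \<and>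
          look s1 (Y, 0) = Num (\<Sum>i=1..k. sim f (g i) (Item x))"])
        show "nat \<lfloor>eval (s((X, 0) \<mapsto> Item x, (Y, 0) \<mapsto> Num 0)) (Var T1)\<rfloor> = t1"
          using inv by (simp add: inv2_def conf_def)
        fix k and s s' :: "(reg, 'u) store"
        assume k: "k < t1" and P: "inv2 g xs s h \<and> look s (X, 0) = Item x \<and>
          look s (Y, 0) = Num (\<Sum>i=1..k. sim f (g i) (Item x))"
          and s': "s' \<in> set_pmf (exec f (Query (scalar Q) (S1, Var I) (scalar X) ;; (scalar Y ::= Var Y \<oplus> Var Q)) (s((I, 0) \<mapsto> Num (real (Suc k)))))"
        have "look s (S1, Suc k) = g (Suc k)" using k P by (auto simp: inv2_def)
        then have "s' = s((I, 0) \<mapsto> Num (real (Suc k)), (Q, 0) \<mapsto> Num (sim f (g (Suc k)) (Item x)),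
            (Y, 0) \<mapsto> Num (\<Sum>i=1..Suc k. sim f (g i) (Item x)))"
          using P s' by (simp add: addr_def bind_return_pmf)
        then show "inv2 g xs s' h \<and> look s' (X, 0) = Item x \<and>
          look s' (Y, 0) = Num (\<Sum>i=1..Suc k. sim f (g i) (Item x))"
          using P by (auto simp: inv2_def conf_def cells_def)
      qed (use inv in \<open>auto simp: inv2_def conf_def cells_def\<close>)
      then show "?post s1" by (simp add: score_def)
    qed
  next
    fix s1 and u :: unit assume post: "?post s1"
    show "rel_pmf (inv2 g (xs @ [x])) (exec f (IfLe (Var Theta) (Var Y) ?heavy ?light) s1) ?A"
    proof (cases "\<theta> \<le> score g x")
      case True
      with post show ?thesis
        by (auto simp: inv2_def conf_def addr_def cells_def heavy_sum_def light_def)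
    next
      case False
      define s2 where "s2 = s1((N2, 0) \<mapsto> Num (real (Suc (length (light g xs)))))"
      have "exec f (IfLe (Var Theta) (Var Y) ?heavy ?light) s1 = exec f ?sample s2"
        using False post
        by (simp add: inv2_def conf_def bind_return_pmf addr_def s2_def add.commute del: exec.simps(6))
      moreover have "rel_pmf (inv2 g (xs @ [x])) (exec f ?sample s2) ?A"
        unfolding if_not_P[OF False]
      proof (rule pmf.rel_mono_strong[OF rel_sample_loop])
        show "look s2 (T2, 0) = Num (real t2)" "look s2 (X, 0) = Item x"
          "look s2 (N2, 0) = Num (real (Suc (length (light g xs))))" "\<forall>i\<in>{1..t2}. look s2 (S2, i) = h i"
          using post by (auto simp: s2_def inv2_def conf_def)
        fix s' h' assume *: "(\<forall>i\<in>{1..t2}. look s' (S2, i) = h' i) \<and>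
          (\<forall>l. l \<notin> insert (I, 0) ({S2} \<times> {1..t2}) \<longrightarrow> look s' l = look s2 l) \<and>
          dom s' \<subseteq> dom s2 \<union> insert (I, 0) ({S2} \<times> {1..t2})"
        have "dom s2 \<union> insert (I, 0) ({S2} \<times> {1..t2}) \<subseteq> cells t1 t2"
          using post by (auto simp: s2_def inv2_def conf_def cells_def)
        with * have "dom s' \<subseteq> cells t1 t2" by blast
        moreover have frame: "look s' l = look s2 l" if "l \<notin> insert (I, 0) ({S2} \<times> {1..t2})" for l
          using * that by blast
        have "look s' (r, 0) = look s2 (r, 0)" if "r \<noteq> I" for r
          using that by (intro frame) auto
        then have "conf s'"
          using post \<open>dom s' \<subseteq> cells t1 t2\<close> by (simp add: inv2_def conf_def s2_def)
        moreover have "look s' (S1, i) = g i" if "i \<in> {1..t1}" for i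
          using frame[of "(S1, i)"] that post by (simp add: inv2_def s2_def)
        moreover have "look s' (D, i) = Num 0" if "i \<in> {1..t2}" for i
          using frame[of "(D, i)"] that post by (simp add: inv2_def s2_def)
        moreover have "look s' (WH, 0) = Num (heavy_sum g (xs @ [x]))"
          using frame[of "(WH, 0)"] post False by (simp add: inv2_def s2_def heavy_sum_def)
        moreover have "look s' (N2, 0) = Num (real (length (light g (xs @ [x]))))"
          using frame[of "(N2, 0)"] post False by (simp add: s2_def light_def)
        ultimately show "inv2 g (xs @ [x]) s' h'"
          unfolding inv2_def using * by blast
      qed simp_all
      ultimately show ?thesis by simp
    qed
  qed
  ultimately show ?thesis by (simp only: bind_return_pmf)
qed

text \<open>Once \<open>g\<close> is fixed, being light is a deterministic property of an item, and
  the pass is reservoir sampling on the filtered stream, with \<open>N2\<close> counting its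
  length.\<close>

lemma rel_pass2:
  assumes "inv1 j s g"
  shows "rel_pmf (inv2 g xs) (exec_phase f xs (Scan X pass2) s) (sample2 (light g xs))"
proof (induction xs rule: rev_induct)
  case Nil
  with assms show ?case
    by (simp add: sample2_def draw_def light_def inv1_def inv2_def fresh_def heavy_sum_def)
next
  case (snoc x xs)
  have "rel_pmf (inv2 g (xs @ [x]))
      (bind_pmf (exec_phase f xs (Scan X pass2) s) (\<lambda>s. exec f pass2 (s((X, 0) \<mapsto> Item x))))
      (bind_pmf (sample2 (light g xs)) (\<lambda>h. if \<theta> \<le> score g x then return_pmf h
     else run_seq (\<lambda>i h. map_pmf (\<lambda>b. h(i := b)) (replace_prob (1 / real (Suc (length (light g xs)))) (Item x) (h i))) [1..<Suc t2] h))"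
    by (rule rel_pmf_bindI[OF snoc.IH]) (rule rel_pass2_step)
  moreover have "bind_pmf (sample2 (light g xs)) (\<lambda>h. if \<theta> \<le> score g x then return_pmf h
     else run_seq (\<lambda>i h. map_pmf (\<lambda>b. h(i := b)) (replace_prob (1 / real (Suc (length (light g xs)))) (Item x) (h i))) [1..<Suc t2] h)
     = sample2 (light g (xs @ [x]))"
  proof (cases "\<theta> \<le> score g x")
    case True
    then show ?thesis by (simp add: light_def bind_return_pmf')
  next
    case False
    then have light: "light g (xs @ [x]) = light g xs @ [x]" by (simp add: light_def)
    show ?thesis
      using Pi_pmf_update_all[of t2 "Num 0" "draw (light g xs)"
          "replace_prob (1 / real (Suc (length (light g xs)))) (Item x)"] False
      by (simp only: sample2_def light draw_snoc if_False)
  qed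
  ultimately show ?case by (simp add: run_seq_snoc del: upt_Suc)
qed

lemma pass3_step:
  assumes inv: "inv3 a m h xs s" and s': "s' \<in> set_pmf (exec f pass3 (s((X, 0) \<mapsto> Item x)))"
  shows "inv3 a m h (xs @ [x]) s'"
proof -
  \<comment> \<open>Within one arrival, the cells up to index k have already received their
    contribution of \<open>x\<close>.\<close>
  let ?P = "\<lambda>k s. conf s \<and> look s (X, 0) = Item x \<and> look s (WH, 0) = Num a \<and> look s (N2, 0) = Num (real m) \<and>
     (\<forall>i\<in>{1..t2}. look s (S2, i) = h i \<and>
        look s (D, i) = Num (sim_sum (if i \<le> k then xs @ [x] else xs) (h i)))"
  have "?P t2 s'"
  proof (rule exec_For_invariant[OF s'[unfolded pass3_def], where P = ?P])
    show "nat \<lfloor>eval (s((X, 0) \<mapsto> Item x)) (Var T2)\<rfloor> = t2" using inv by (simp add: inv3_def conf_def)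
    fix k and s s' :: "(reg, 'u) store"
    assume k: "k < t2" and P: "?P k s"
      and s': "s' \<in> set_pmf (exec f (Query (scalar Q) (S2, Var I) (scalar X) ;; ((D, Var I) ::= Load D (Var I) \<oplus> Var Q)) (s((I, 0) \<mapsto> Num (real (Suc k)))))"
    have "s' = s((I, 0) \<mapsto> Num (real (Suc k)), (Q, 0) \<mapsto> Num (sim f (h (Suc k)) (Item x)),
        (D, Suc k) \<mapsto> Num (sim_sum (xs @ [x]) (h (Suc k))))"
      using k P s' by (auto simp: addr_def bind_return_pmf sim_sum_def)
    then show "?P (Suc k) s'"
      using k P by (auto simp: conf_def cells_def)
  qed (use inv in \<open>auto simp: inv3_def conf_def cells_def\<close>)
  then show ?thesis by (auto simp: inv3_def)
qed

text \<open>The list \<open>ys\<close> is separate from \<open>xs\<close>: the induction runs over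
  prefixes of the third scan, whereas the second scan is complete.\<close>

lemma pass3:
  assumes "inv2 g xs s h" "s' \<in> set_pmf (exec_phase f ys (Scan X pass3) s)"
  shows "inv3 (heavy_sum g xs) (length (light g xs)) h ys s'"
  using assms(2)
proof (induction ys arbitrary: s' rule: rev_induct)
  case Nil
  with assms(1) show ?case by (simp add: inv2_def inv3_def sim_sum_def)
next
  case (snoc y ys)
  then show ?case by (auto simp: run_seq_snoc intro: pass3_step)
qed

lemma finish:
  assumes inv: "inv3 a m h xs s" and s': "s' \<in> set_pmf (exec f finish s)"
  shows "look s' (Out, 0) = Num (a + real m / real t2 * (\<Sum>i=1..t2. 1 / sim_sum xs (h i)))
    \<and> dom s' \<subseteq> cells t1 t2"
proof -
  let ?loop = "For I (Var T2) (scalar WL ::= Var WL \<oplus> Const 1 \<oslash> Load D (Var I))"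
  define s1 where "s1 = s((WL, 0) \<mapsto> Num 0)"
  have s1: "inv3 a m h xs s1" "look s1 (WL, 0) = Num 0"
    using inv by (auto simp: s1_def inv3_def conf_def cells_def)
  have eq: "exec f finish s = bind_pmf
      (exec f (IfLe (Var N2) (Const 0) (scalar WL ::= Const 0) (?loop ;; (scalar WL ::= Var N2 \<oslash> Var T2 \<otimes> Var WL))) s1)
      (exec f (scalar Out ::= Var WH \<oplus> Var WL))"
    unfolding finish_def s1_def by (simp add: bind_return_pmf addr_def del: exec.simps(5,6))
  show ?thesis
  proof (cases "m = 0")
    case True
    \<comment> \<open>The program branches to \<open>WL = 0\<close>, in agreement with the factor
      \<open>real m = 0\<close> of the formula.\<close>
    with s1 s' show ?thesis
      unfolding eq by (auto simp: inv3_def conf_def addr_def cells_def bind_return_pmf)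
  next
    case False
    with s1 s' obtain s2 where s2: "s2 \<in> set_pmf (exec f ?loop s1)"
      and s'2: "s' \<in> set_pmf (bind_pmf (exec f (scalar WL ::= Var N2 \<oslash> Var T2 \<otimes> Var WL) s2) (exec f (scalar Out ::= Var WH \<oplus> Var WL)))"
      unfolding eq by (auto simp: inv3_def bind_assoc_pmf simp del: exec.simps(6))
    have "inv3 a m h xs s2 \<and> look s2 (WL, 0) = Num (\<Sum>i=1..t2. 1 / sim_sum xs (h i))"
    proof (rule exec_For_invariant[OF s2, where P = "\<lambda>k s2. inv3 a m h xs s2 \<and>
        look s2 (WL, 0) = Num (\<Sum>i=1..k. 1 / sim_sum xs (h i))"])
      show "nat \<lfloor>eval s1 (Var T2)\<rfloor> = t2" using s1 by (simp add: inv3_def conf_def)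
      fix k and s s' :: "(reg, 'u) store"
      assume "k < t2" "inv3 a m h xs s \<and> look s (WL, 0) = Num (\<Sum>i=1..k. 1 / sim_sum xs (h i))"
        "s' \<in> set_pmf (exec f (scalar WL ::= Var WL \<oplus> Const 1 \<oslash> Load D (Var I)) (s((I, 0) \<mapsto> Num (real (Suc k)))))"
      then show "inv3 a m h xs s' \<and> look s' (WL, 0) = Num (\<Sum>i=1..Suc k. 1 / sim_sum xs (h i))"
        by (auto simp: inv3_def conf_def addr_def cells_def)
    qed (use s1 in auto)
    with s'2 show ?thesis
      by (auto simp: inv3_def conf_def addr_def cells_def bind_return_pmf)
  qed
qed

text \<open>The couplings of the passes compose. The relation contains the output value, for the
  approximation, and the domain, for the space bound.\<close>

lemma rel_run_A:
  assumes n: "n = real (length \<sigma>)"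
    and t1: "of_int \<lceil>48 * sqrt n * ln n / (\<epsilon> * \<epsilon>)\<rceil> = real t1"
    and t2: "of_int \<lceil>36 * sqrt n * ln n / (\<epsilon> * \<epsilon>)\<rceil> = real t2"
    and \<theta>: "96 * ln n / (\<epsilon> * \<epsilon>) = \<theta>"
  shows "rel_pmf (\<lambda>s y. num (look s (Out, 0)) = y \<and> dom s \<subseteq> cells t1 t2) (run_A f \<sigma> \<epsilon>)
    (bind_pmf (sample1 \<sigma>) (\<lambda>g. map_pmf (estimate \<sigma> g) (sample2 (light g \<sigma>))))"
proof -
  have "rel_pmf (\<lambda>s y. num (look s (Out, 0)) = y \<and> dom s \<subseteq> cells t1 t2)
     (bind_pmf (exec f initialize [(N, 0) \<mapsto> Num n, (Eps, 0) \<mapsto> Num \<epsilon>])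
        (\<lambda>s. bind_pmf (exec_phase f \<sigma> (Scan X pass1) s) (\<lambda>s. bind_pmf (exec_phase f \<sigma> (Scan X pass2) s)
          (\<lambda>s. bind_pmf (exec_phase f \<sigma> (Scan X pass3) s) (exec f finish)))))
     (bind_pmf (return_pmf ()) (\<lambda>_. bind_pmf (sample1 \<sigma>) (\<lambda>g. bind_pmf (sample2 (light g \<sigma>)) (\<lambda>h. return_pmf (estimate \<sigma> g h)))))"
  proof (rule rel_pmf_bindI)
    show "rel_pmf (\<lambda>s _. inv1 0 s (\<lambda>_. Num 0)) (exec f initialize [(N, 0) \<mapsto> Num n, (Eps, 0) \<mapsto> Num \<epsilon>]) (return_pmf ())"
      unfolding rel_pmf_return_pmf2 by (auto intro: initialize t1 t2 \<theta>)
  next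
    fix s and u :: unit assume "inv1 0 s (\<lambda>_. Num 0)"
    then show "rel_pmf (\<lambda>s y. num (look s (Out, 0)) = y \<and> dom s \<subseteq> cells t1 t2)
     (bind_pmf (exec_phase f \<sigma> (Scan X pass1) s) (\<lambda>s. bind_pmf (exec_phase f \<sigma> (Scan X pass2) s)
          (\<lambda>s. bind_pmf (exec_phase f \<sigma> (Scan X pass3) s) (exec f finish))))
     (bind_pmf (sample1 \<sigma>) (\<lambda>g. bind_pmf (sample2 (light g \<sigma>)) (\<lambda>h. return_pmf (estimate \<sigma> g h))))"
    proof (rule rel_pmf_bindI[OF rel_pass1], goal_cases)
      case (1 s g)
      then show ?case
      proof (rule rel_pmf_bindI[OF rel_pass2], goal_cases)
        case (1 s h)
        show ?case
          unfolding rel_pmf_return_pmf2 estimate_def using finish pass3[OF 1] by fastforce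
      qed
    qed
  qed
  moreover have "run_A f \<sigma> \<epsilon> = bind_pmf (exec f initialize [(N, 0) \<mapsto> Num n, (Eps, 0) \<mapsto> Num \<epsilon>])
      (\<lambda>s. bind_pmf (exec_phase f \<sigma> (Scan X pass1) s) (\<lambda>s. bind_pmf (exec_phase f \<sigma> (Scan X pass2) s)
        (\<lambda>s. bind_pmf (exec_phase f \<sigma> (Scan X pass3) s) (exec f finish))))"
    by (simp only: run_A_def run_def algorithm_A_def n[symmetric] run_seq_Nil run_seq_Cons bind_return_pmf'
      exec_phase.simps(1))
  ultimately show ?thesis
    by (simp only: bind_return_pmf map_pmf_def)
qed

lemma output_A_eq:
  assumes "n = real (length \<sigma>)"
    and "of_int \<lceil>48 * sqrt n * ln n / (\<epsilon> * \<epsilon>)\<rceil> = real t1"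
    and "of_int \<lceil>36 * sqrt n * ln n / (\<epsilon> * \<epsilon>)\<rceil> = real t2"
    and "96 * ln n / (\<epsilon> * \<epsilon>) = \<theta>"
  shows "output_A f \<sigma> \<epsilon> = bind_pmf (sample1 \<sigma>) (\<lambda>g. map_pmf (estimate \<sigma> g) (sample2 (light g \<sigma>)))"
proof -
  have "rel_pmf (=) (output_A f \<sigma> \<epsilon>) (bind_pmf (sample1 \<sigma>) (\<lambda>g. map_pmf (estimate \<sigma> g) (sample2 (light g \<sigma>))))"
    unfolding output_A_def pmf.rel_map
    by (rule pmf.rel_mono_strong[OF rel_run_A[OF assms]]) simp
  then show ?thesis by (simp add: pmf.rel_eq)
qed

text \<open>Every store in the support has a partner in the coupling, so it satisfies the domain
  part of the relation.\<close>

lemma dom_run_A: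
  assumes "n = real (length \<sigma>)"
    and "of_int \<lceil>48 * sqrt n * ln n / (\<epsilon> * \<epsilon>)\<rceil> = real t1"
    and "of_int \<lceil>36 * sqrt n * ln n / (\<epsilon> * \<epsilon>)\<rceil> = real t2"
    and "96 * ln n / (\<epsilon> * \<epsilon>) = \<theta>"
    and "s \<in> set_pmf (run_A f \<sigma> \<epsilon>)"
  shows "dom s \<subseteq> cells t1 t2"
  using rel_setD1[OF pmf.set_transfer[THEN rel_funD, OF rel_run_A[OF assms(1-4)]] assms(5)] by auto

end

subsection \<open>Error analysis\<close>

lemma sum_list_filter_partition:
  fixes h :: "'a \<Rightarrow> 'b :: comm_monoid_add"
  shows "(\<Sum>x\<leftarrow>filter P xs. h x) + (\<Sum>x\<leftarrow>filter (\<lambda>x. \<not> P x) xs. h x) = (\<Sum>x\<leftarrow>xs. h x)"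
  by (induction xs) (auto simp: ac_simps)

lemma abs_sum_list_diff_le:
  fixes h k b :: "'a \<Rightarrow> real"
  assumes "\<And>x. x \<in> set xs \<Longrightarrow> \<bar>h x - k x\<bar> \<le> b x"
  shows "\<bar>(\<Sum>x\<leftarrow>xs. h x) - (\<Sum>x\<leftarrow>xs. k x)\<bar> \<le> (\<Sum>x\<leftarrow>xs. b x)"
  using assms by (induction xs) force+

text \<open>Since \<open>r\<close> is at least \<open>d / 2\<close>, passing to reciprocals at most
  doubles the relative error. This is why scores are required to be accurate up to
  \<epsilon>/2.\<close>

lemma abs_inverse_diff_le:
  fixes d r \<epsilon> :: real
  assumes "0 < d" "0 < \<epsilon>" "\<epsilon> < 1" "\<bar>r - d\<bar> \<le> \<epsilon> / 2 * d"
  shows "\<bar>1 / r - 1 / d\<bar> \<le> \<epsilon> * (1 / d)"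
proof -
  have "\<epsilon> * d \<le> d" using assms by simp
  with assms have r: "d / 2 \<le> r" by linarith
  then have "0 < r" using assms by linarith
  have "1 / r - 1 / d = (d - r) / (r * d)" using \<open>0 < r\<close> \<open>0 < d\<close> by (simp add: field_simps)
  then have "\<bar>1 / r - 1 / d\<bar> = \<bar>r - d\<bar> / (r * d)"
    using \<open>0 < r\<close> \<open>0 < d\<close> by (simp add: abs_mult abs_minus_commute)
  also have "\<dots> \<le> (\<epsilon> / 2 * d) / (d / 2 * d)"
    using assms r by (intro frac_le mult_right_mono) auto
  also have "\<dots> = \<epsilon> * (1 / d)" using assms by (simp add: field_simps)
  finally show ?thesis .
qed

lemma exp_minus_mult_ln: "0 < n \<Longrightarrow> exp (- (real k * ln n)) = 1 / n ^ k"
  by (simp add: exp_minus exp_of_nat_mult inverse_eq_divide)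

text \<open>The bounds on the array sizes absorb rounding. For \<open>t1\<close> an upper bound is
  included as well, because the mean score of a low-degree item grows with \<open>t1\<close> and has
  to stay below \<theta>.\<close>

locale sampling_analysis = sampling f n \<theta> t1 t2
  for f :: "'u \<Rightarrow> 'u \<Rightarrow> real" and n \<theta> :: real and t1 t2 :: nat +
  fixes \<sigma> :: "'u list" and \<epsilon> :: real
  assumes f: "similarity f" and n: "n = real (length \<sigma>)" and n2: "2 \<le> n"
    and \<epsilon>: "0 < \<epsilon>" "\<epsilon> < 1"
    and t1_ge: "48 * sqrt n * ln n / \<epsilon>\<^sup>2 \<le> real t1"
    and t1_le: "real t1 \<le> 48 * sqrt n * ln n / \<epsilon>\<^sup>2 + 1"
    and t2_ge: "36 * sqrt n * ln n / \<epsilon>\<^sup>2 \<le> real t2"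
    and \<theta>: "\<theta> = 96 * ln n / \<epsilon>\<^sup>2"
begin

section \<open>Degrees and mean scores\<close>

abbreviation deg :: "'u \<Rightarrow> real" where
  "deg x \<equiv> sim_sum \<sigma> (Item x)"

lemma ln_n: "2 / 3 \<le> ln n"
  using ln2_ge_two_thirds n2 ln_le_cancel_iff[of 2 n] by linarith

lemma f_bounds: "0 \<le> f x y" "f x y \<le> 1" "f x x = 1" "f x y = f y x"
  using f by (auto simp: similarity_def)

lemma sim_bounds: "0 \<le> sim f v w \<and> sim f v w \<le> 1"
  by (cases "(f, v, w)" rule: sim.cases) (auto simp: f_bounds)

text \<open>The self-loop contributes 1. Hence \<open>1 / deg x\<close> lies in [0, 1], the range
  required by the Chernoff bound.\<close>

lemma deg_ge_1: assumes "x \<in> set \<sigma>" shows "1 \<le> deg x"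
proof -
  obtain ys zs where "\<sigma> = ys @ x # zs" using split_list[OF assms] by blast
  moreover have "0 \<le> (\<Sum>y\<leftarrow>ys. f x y)" for ys by (intro sum_list_nonneg) (auto simp: f_bounds)
  ultimately show ?thesis using f_bounds(3)[of x] by (simp add: sim_sum_def add_nonneg_nonneg)
qed

lemma diversity_index_eq: "diversity_index f \<sigma> = (\<Sum>x\<leftarrow>\<sigma>. 1 / deg x)"
  by (simp add: diversity_index_def degree_def weight_def sim_sum_def sum_list_sum_nth
      lessThan_atLeast0 inverse_eq_divide)

lemma sigma_nonempty: "\<sigma> \<noteq> []"
  using n n2 by auto

lemma expectation_sim: "measure_pmf.expectation (draw \<sigma>) (\<lambda>w. sim f w (Item x)) = deg x / n"
  using f_bounds(4) by (simp add: expectation_draw sigma_nonempty sim_sum_def n cong: map_cong)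

definition mean_score :: "'u \<Rightarrow> real" where
  "mean_score x = real t1 * (deg x / n)"

lemma sqrt_n: "0 < sqrt n" "sqrt n * sqrt n = n"
  using n2 by auto

text \<open>Applied with c = 1 for the concentration of scores and with c = 4 for the degrees of
  light items.\<close>

lemma mean_score_ge:
  assumes "0 \<le> c" "c * sqrt n \<le> deg x" shows "48 * c * ln n / \<epsilon>\<^sup>2 \<le> mean_score x"
proof -
  have "48 * c * ln n / \<epsilon>\<^sup>2 = (48 * sqrt n * ln n / \<epsilon>\<^sup>2) * (c * sqrt n / n)"
    using sqrt_n n2 \<epsilon> by (simp add: field_simps)
  also have "\<dots> \<le> real t1 * (deg x / n)"
    using assms t1_ge n2 sqrt_n by (intro mult_mono divide_right_mono) auto
  finally show ?thesis by (simp add: mean_score_def)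
qed

text \<open>The summand 1 pays for the rounding of \<open>t1\<close>, which adds at most
  \<open>1 / sqrt n\<close> to the mean.\<close>

lemma mean_score_le:
  assumes "deg x < sqrt n" shows "mean_score x \<le> \<theta> / 2 + 1"
proof -
  have "mean_score x \<le> (48 * sqrt n * ln n / \<epsilon>\<^sup>2 + 1) * (sqrt n / n)"
    unfolding mean_score_def using assms n2 t1_le ln_n sqrt_n
    by (intro mult_mono divide_right_mono) (auto simp: sim_sum_def f_bounds intro!: sum_list_nonneg divide_nonneg_nonneg)
  also have "sqrt n / n = 1 / sqrt n"
    using sqrt_n n2 by (simp add: field_simps)
  also have "(48 * sqrt n * ln n / \<epsilon>\<^sup>2 + 1) * (1 / sqrt n) = \<theta> / 2 + 1 / sqrt n"
    using sqrt_n(1) \<epsilon> by (simp add: field_simps \<theta>)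
  also have "1 / sqrt n \<le> 1" using n2 by simp
  finally show ?thesis by simp
qed

text \<open>Low degrees only have to be classified as light. So under accuracy every heavy item has
  degree at least \<open>sqrt n\<close> and a score with small relative error.\<close>

definition accurate :: "(nat \<Rightarrow> 'u word) \<Rightarrow> 'u \<Rightarrow> bool" where
  "accurate g x \<longleftrightarrow> (sqrt n \<le> deg x \<longrightarrow> \<bar>score g x - mean_score x\<bar> \<le> \<epsilon> / 2 * mean_score x) \<and>
     (deg x < sqrt n \<longrightarrow> score g x < \<theta>)"

text \<open>The exponent 3 leaves room for a union bound over n items.\<close>

lemma prob_inaccurate: "measure_pmf.prob (sample1 \<sigma>) {g. \<not> accurate g x} \<le> 2 / n ^ 3"
proof (cases "sqrt n \<le> deg x")
  case True
  have "measure_pmf.prob (sample1 \<sigma>) {g. \<epsilon> / 2 * mean_score x < \<bar>score g x - mean_score x\<bar>}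
      \<le> 2 * exp (- ((\<epsilon> / 2)\<^sup>2 * mean_score x / 4))"
    using chernoff_Pi_pmf[of "draw \<sigma>" "\<lambda>w. sim f w (Item x)" "\<epsilon> / 2" t1 "Num 0"] sim_bounds \<epsilon>
    unfolding sample1_def score_def mean_score_def expectation_sim by simp
  also have "{g. \<epsilon> / 2 * mean_score x < \<bar>score g x - mean_score x\<bar>} = {g. \<not> accurate g x}"
    using True by (auto simp: accurate_def)
  \<comment> \<open>The mean is at least \<open>48 * ln n / \<epsilon>\<^sup>2\<close>, and 48 / 16
    = 3.\<close>
  also have "3 * ln n \<le> (\<epsilon> / 2)\<^sup>2 * mean_score x / 4"
    using mean_score_ge[of 1 x] True \<epsilon> by (simp add: field_simps)
  then have "2 * exp (- ((\<epsilon> / 2)\<^sup>2 * mean_score x / 4)) \<le> 2 * exp (- (real 3 * ln n))" by simp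
  also have "\<dots> = 2 / n ^ 3" using exp_minus_mult_ln[of n 3] n2 by simp
  finally show ?thesis .
next
  case False
  \<comment> \<open>The mean may be tiny here, so a relative deviation bound is useless; the tail
    beyond the absolute value \<theta> is taken with s = 1/2.\<close>
  have "measure_pmf.prob (sample1 \<sigma>) {g. 1 / 2 * \<theta> \<le> 1 / 2 * score g x}
      \<le> exp (mean_score x * (1 / 2 + (1 / 2)\<^sup>2) - 1 / 2 * \<theta>)"
    using tail_Pi_pmf_le[of "draw \<sigma>" "\<lambda>w. sim f w (Item x)" "1 / 2" t1 "Num 0" \<theta>] sim_bounds
    unfolding sample1_def score_def mean_score_def expectation_sim by simp
  also have "{g. 1 / 2 * \<theta> \<le> 1 / 2 * score g x} = {g. \<not> accurate g x}"
    using False by (auto simp: accurate_def)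
  \<comment> \<open>The left side is at most (3/4) (\<theta>/2 + 1) - \<theta>/2 = 3/4 - \<theta>/8,
    and \<theta>/8 is at least \<open>12 * ln n\<close>.\<close>
  also have "mean_score x * (1 / 2 + (1 / 2)\<^sup>2) - 1 / 2 * \<theta> \<le> - (real 3 * ln n)"
  proof -
    have "\<epsilon>\<^sup>2 \<le> 1" using \<epsilon> by (simp add: power_le_one)
    then have "96 * ln n \<le> \<theta>"
      using ln_n \<epsilon> mult_left_mono[of "\<epsilon>\<^sup>2" 1 "96 * ln n"] by (simp add: \<theta> field_simps)
    then show ?thesis using mean_score_le[of x] False ln_n by (simp add: power2_eq_square)
  qed
  then have "exp (mean_score x * (1 / 2 + (1 / 2)\<^sup>2) - 1 / 2 * \<theta>) \<le> exp (- (real 3 * ln n))" by simp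
  also have "\<dots> = 1 / n ^ 3" using exp_minus_mult_ln[of n 3] n2 by simp
  also have "\<dots> \<le> 2 / n ^ 3" using n2 by (intro divide_right_mono) auto
  finally show ?thesis .
qed

text \<open>A score depends on the item alone, so the union bound runs over the distinct items, of
  which there are at most n.\<close>

lemma prob_some_inaccurate:
  "measure_pmf.prob (sample1 \<sigma>) (- {g. \<forall>x\<in>set \<sigma>. accurate g x}) \<le> 2 / n\<^sup>2"
proof -
  have "- {g. \<forall>x\<in>set \<sigma>. accurate g x} = (\<Union>x\<in>set \<sigma>. {g. \<not> accurate g x})" by auto
  also have "measure_pmf.prob (sample1 \<sigma>) \<dots> \<le> (\<Sum>x\<in>set \<sigma>. measure_pmf.prob (sample1 \<sigma>) {g. \<not> accurate g x})"
    by (intro measure_UNION_le) auto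
  also have "\<dots> \<le> (\<Sum>x\<in>set \<sigma>. 2 / n ^ 3)" by (intro sum_mono prob_inaccurate)
  also have "\<dots> \<le> n * (2 / n ^ 3)"
    using card_length[of \<sigma>] n n2 by (simp add: divide_right_mono)
  also have "\<dots> = 2 / n\<^sup>2" using n2 by (simp add: power_numeral_reduce)
  finally show ?thesis .
qed

lemma heavy_sum_error:
  assumes "\<forall>x\<in>set \<sigma>. accurate g x"
  shows "\<bar>heavy_sum g \<sigma> - (\<Sum>x\<leftarrow>filter (\<lambda>x. \<theta> \<le> score g x) \<sigma>. 1 / deg x)\<bar>
    \<le> \<epsilon> * (\<Sum>x\<leftarrow>filter (\<lambda>x. \<theta> \<le> score g x) \<sigma>. 1 / deg x)"
  unfolding heavy_sum_def sum_list_const_mult[symmetric]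
proof (rule abs_sum_list_diff_le)
  fix x assume x: "x \<in> set (filter (\<lambda>x. \<theta> \<le> score g x) \<sigma>)"
  then have "accurate g x" "\<theta> \<le> score g x" using assms by auto
  \<comment> \<open>A score of at least \<theta> rules out the low-degree case of
    \<open>accurate\<close>.\<close>
  then have *: "\<bar>score g x - mean_score x\<bar> \<le> \<epsilon> / 2 * mean_score x"
    by (auto simp: accurate_def)
  have d: "1 \<le> deg x" using x by (intro deg_ge_1) auto
  have "0 < 48 * sqrt n * ln n / \<epsilon>\<^sup>2" using n2 ln_n \<epsilon> by simp
  with t1_ge have t1: "0 < real t1" by linarith
  have "n / real t1 * score g x - deg x = n / real t1 * (score g x - mean_score x)"
    using t1 n2 by (simp add: mean_score_def field_simps)
  then have "\<bar>n / real t1 * score g x - deg x\<bar> = n / real t1 * \<bar>score g x - mean_score x\<bar>"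
    using t1 n2 by (simp add: abs_mult)
  also have "\<dots> \<le> n / real t1 * (\<epsilon> / 2 * mean_score x)"
    using * n2 by (intro mult_left_mono) auto
  also have "\<dots> = \<epsilon> / 2 * deg x"
    using t1 n2 by (simp add: mean_score_def)
  finally show "\<bar>1 / (n / real t1 * score g x) - 1 / deg x\<bar> \<le> \<epsilon> * (1 / deg x)"
    using d \<epsilon> by (intro abs_inverse_diff_le) auto
qed

text \<open>A larger degree would give a mean score of at least 2 \<theta>, and an accurate score is
  at least half its mean, so the item would be heavy.\<close>

lemma deg_light:
  assumes "\<forall>x\<in>set \<sigma>. accurate g x" "x \<in> set (light g \<sigma>)"
  shows "deg x \<le> 4 * sqrt n"
proof (rule ccontr)
  assume "\<not> deg x \<le> 4 * sqrt n"
  then have deg: "4 * sqrt n \<le> deg x" "sqrt n \<le> deg x" using sqrt_n by linarith+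
  have "accurate g x" "score g x < \<theta>" using assms by (auto simp: light_def)
  with deg have *: "\<bar>score g x - mean_score x\<bar> \<le> \<epsilon> / 2 * mean_score x"
    by (auto simp: accurate_def)
  have "2 * \<theta> \<le> mean_score x" using mean_score_ge[of 4 x] deg by (simp add: \<theta>)
  moreover have "0 < \<theta>" using ln_n \<epsilon> by (simp add: \<theta>)
  ultimately have "\<epsilon> * mean_score x \<le> mean_score x" using \<epsilon> by simp
  with * \<open>score g x < \<theta>\<close> \<open>2 * \<theta> \<le> mean_score x\<close> show False by linarith
qed

text \<open>The draws of \<open>1 / deg\<close> have mean \<open>A / length l\<close>, at least
  \<open>1 / (4 * sqrt n)\<close> because light degrees are small, so the Chernoff bound applies
  with relative error \<epsilon>.\<close>

lemma light_sum_error: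
  assumes acc: "\<forall>x\<in>set \<sigma>. accurate g x"
  defines "l \<equiv> light g \<sigma>"
  defines "A \<equiv> \<Sum>x\<leftarrow>l. 1 / deg x"
  shows "measure_pmf.prob (sample2 l)
    {h. \<epsilon> * A < \<bar>real (length l) / real t2 * (\<Sum>i=1..t2. 1 / sim_sum \<sigma> (h i)) - A\<bar>} \<le> 2 / n\<^sup>2"
proof (cases "l = []")
  case True
  \<comment> \<open>Both sides of the strict inequality are 0, so the event is empty.\<close>
  then show ?thesis using n2 by (simp add: A_def)
next
  case False
  define k where "k = real (length l)"
  have k: "0 < k" using False by (simp add: k_def)
  have t2: "0 < real t2"
  proof -
    have "0 < 36 * sqrt n * ln n / \<epsilon>\<^sup>2" using n2 ln_n \<epsilon> by simp
    with t2_ge show ?thesis by linarith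
  qed
  have l: "x \<in> set l \<Longrightarrow> x \<in> set \<sigma>" for x by (auto simp: l_def light_def)
  have expectation: "measure_pmf.expectation (draw l) (\<lambda>w. 1 / sim_sum \<sigma> w) = A / k"
    using False by (simp add: expectation_draw A_def k_def)
  have bounds: "0 \<le> 1 / sim_sum \<sigma> w \<and> 1 / sim_sum \<sigma> w \<le> 1" if "w \<in> set_pmf (draw l)" for w
    using that False deg_ge_1 l by (force simp: set_pmf_draw)
  \<comment> \<open>The expected value of the sum over the \<open>t2\<close> draws.\<close>
  define M where "M = real t2 * (A / k)"
  have "measure_pmf.prob (sample2 l) {h. \<epsilon> * M < \<bar>(\<Sum>i=1..t2. 1 / sim_sum \<sigma> (h i)) - M\<bar>}
      \<le> 2 * exp (- (\<epsilon>\<^sup>2 * M / 4))"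
    using chernoff_Pi_pmf[of "draw l" "\<lambda>w. 1 / sim_sum \<sigma> w" \<epsilon> t2 "Num 0"] bounds \<epsilon>
    unfolding sample2_def M_def expectation by simp
  also have "{h. \<epsilon> * M < \<bar>(\<Sum>i=1..t2. 1 / sim_sum \<sigma> (h i)) - M\<bar>} =
      {h. \<epsilon> * A < \<bar>k / real t2 * (\<Sum>i=1..t2. 1 / sim_sum \<sigma> (h i)) - A\<bar>}"
  proof (rule Collect_cong)
    fix h
    let ?S = "\<Sum>i=1..t2. 1 / sim_sum \<sigma> (h i)"
    have "k / real t2 * ?S - A = k / real t2 * (?S - M)"
      using k t2 by (simp add: M_def field_simps)
    then have "\<bar>k / real t2 * ?S - A\<bar> = k / real t2 * \<bar>?S - M\<bar>" using k by (simp add: abs_mult)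
    moreover have "\<epsilon> * A = k / real t2 * (\<epsilon> * M)" using k t2 by (simp add: M_def)
    moreover have "0 < k / real t2" using k t2 by simp
    ultimately show "\<epsilon> * M < \<bar>?S - M\<bar> \<longleftrightarrow> \<epsilon> * A < \<bar>k / real t2 * ?S - A\<bar>"
      by (simp only: mult_less_cancel_left_pos)
  qed
  \<comment> \<open>\<open>M\<close> is at least \<open>9 * ln n / \<epsilon>\<^sup>2\<close>, as 36
    / 4 = 9, and 9/4 exceeds 2.\<close>
  also have "2 * ln n \<le> \<epsilon>\<^sup>2 * M / 4"
  proof -
    have "(\<Sum>x\<leftarrow>l. 1 / (4 * sqrt n)) \<le> A"
      unfolding A_def
    proof (rule sum_list_mono)
      fix x assume "x \<in> set l"
      then have "deg x \<le> 4 * sqrt n" "1 \<le> deg x"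
        using deg_light[OF acc] deg_ge_1[OF l] by (auto simp: l_def)
      then show "1 / (4 * sqrt n) \<le> 1 / deg x" by (intro frac_le) auto
    qed
    then have "1 / (4 * sqrt n) \<le> A / k"
      using k by (simp add: sum_list_triv k_def field_simps)
    then have "36 * sqrt n * ln n / \<epsilon>\<^sup>2 * (1 / (4 * sqrt n)) \<le> M"
      unfolding M_def using t2_ge t2 sqrt_n by (intro mult_mono) auto
    then have "9 * ln n / \<epsilon>\<^sup>2 \<le> M" using sqrt_n by simp
    then have "9 * ln n \<le> \<epsilon>\<^sup>2 * M" using \<epsilon> by (simp add: field_simps)
    then show ?thesis using ln_n by linarith
  qed
  then have "2 * exp (- (\<epsilon>\<^sup>2 * M / 4)) \<le> 2 * exp (- (real 2 * ln n))" by simp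
  also have "\<dots> = 2 / n\<^sup>2" using exp_minus_mult_ln[of n 2] n2 by simp
  finally show ?thesis by (simp add: k_def)
qed

text \<open>Each sampling stage fails with probability at most \<open>2 / n\<^sup>2\<close>. If the
  first succeeds, the heavy part has relative error at most \<epsilon> with certainty.\<close>

lemma approximates_estimate:
  "approximates \<epsilon> (4 / n\<^sup>2)
     (bind_pmf (sample1 \<sigma>) (\<lambda>g. map_pmf (estimate \<sigma> g) (sample2 (light g \<sigma>)))) (diversity_index f \<sigma>)"
proof -
  let ?P = "bind_pmf (sample1 \<sigma>) (\<lambda>g. map_pmf (estimate \<sigma> g) (sample2 (light g \<sigma>)))"
  let ?DI = "diversity_index f \<sigma>"
  let ?G = "{x. (1 - \<epsilon>) * ?DI \<le> x \<and> x \<le> (1 + \<epsilon>) * ?DI}"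
  have "measure_pmf.prob ?P (- ?G) \<le> 2 / n\<^sup>2 + 2 / n\<^sup>2"
  proof (rule prob_bind_le[OF prob_some_inaccurate])
    fix g assume "g \<in> {g. \<forall>x\<in>set \<sigma>. accurate g x}"
    then have acc: "\<forall>x\<in>set \<sigma>. accurate g x" by simp
    define l where "l = light g \<sigma>"
    define A where "A = (\<Sum>x\<leftarrow>l. 1 / deg x)"
    define H where "H = (\<Sum>x\<leftarrow>filter (\<lambda>x. \<theta> \<le> score g x) \<sigma>. 1 / deg x)"
    have DI: "?DI = H + A"
      unfolding diversity_index_eq H_def A_def l_def light_def
      by (rule sum_list_filter_partition[symmetric])
    have heavy: "\<bar>heavy_sum g \<sigma> - H\<bar> \<le> \<epsilon> * H"
      using heavy_sum_error[OF acc] by (simp add: H_def)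
    have "measure_pmf.prob (map_pmf (estimate \<sigma> g) (sample2 l)) (- ?G) =
        measure_pmf.prob (sample2 l) (estimate \<sigma> g -` (- ?G))" by simp
    also have "\<dots> \<le> measure_pmf.prob (sample2 l)
        {h. \<epsilon> * A < \<bar>real (length l) / real t2 * (\<Sum>i=1..t2. 1 / sim_sum \<sigma> (h i)) - A\<bar>}"
    proof (intro measure_pmf.finite_measure_mono subsetI)
      fix h assume "h \<in> estimate \<sigma> g -` (- ?G)"
      moreover have "\<bar>estimate \<sigma> g h - ?DI\<bar> \<le> \<epsilon> * ?DI \<Longrightarrow> estimate \<sigma> g h \<in> ?G"
        by (auto simp: abs_le_iff algebra_simps)
      ultimately have *: "\<epsilon> * ?DI < \<bar>estimate \<sigma> g h - ?DI\<bar>" by force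
      \<comment> \<open>The heavy part errs by at most \<open>\<epsilon> * H\<close>, so a total
        error above \<open>\<epsilon> * (H + A)\<close> forces the light part to err by more than
        \<open>\<epsilon> * A\<close>.\<close>
      show "h \<in> {h. \<epsilon> * A < \<bar>real (length l) / real t2 * (\<Sum>i=1..t2. 1 / sim_sum \<sigma> (h i)) - A\<bar>}"
        using * heavy unfolding DI estimate_def l_def[symmetric] distrib_left by (simp; linarith)
    qed simp
    also have "\<dots> \<le> 2 / n\<^sup>2"
      using light_sum_error[OF acc] by (simp add: l_def A_def)
    finally show "measure_pmf.prob (map_pmf (estimate \<sigma> g) (sample2 (light g \<sigma>))) (- ?G) \<le> 2 / n\<^sup>2"
      by (simp add: l_def)
  qed (use n2 in simp)
  moreover have "measure_pmf.prob ?P (- ?G) = 1 - measure_pmf.prob ?P ?G"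
    using measure_pmf.prob_compl[of ?G ?P] by (simp add: Compl_eq_Diff_UNIV)
  ultimately show ?thesis by (simp add: approximates_def)
qed

end

section \<open>Array sizes, approximation and space for a given stream\<close>

context
  fixes f :: "'u \<Rightarrow> 'u \<Rightarrow> real" and \<sigma> :: "'u list" and \<epsilon> :: real
  assumes f: "similarity f" and \<epsilon>: "0 < \<epsilon>" "\<epsilon> < 1" and len: "2 \<le> length \<sigma>"
begin

lemma array_size:
  assumes "0 < c"
  defines "z \<equiv> c * sqrt (real (length \<sigma>)) * ln (real (length \<sigma>)) / \<epsilon>\<^sup>2"
  shows "of_int \<lceil>c * sqrt (real (length \<sigma>)) * ln (real (length \<sigma>)) / (\<epsilon> * \<epsilon>)\<rceil> = real (nat \<lceil>z\<rceil>)"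
    and "z \<le> real (nat \<lceil>z\<rceil>)" "real (nat \<lceil>z\<rceil>) \<le> z + 1"
proof -
  have "0 \<le> z" using len assms by simp
  then show "of_int \<lceil>c * sqrt (real (length \<sigma>)) * ln (real (length \<sigma>)) / (\<epsilon> * \<epsilon>)\<rceil> = real (nat \<lceil>z\<rceil>)"
    and "z \<le> real (nat \<lceil>z\<rceil>)" "real (nat \<lceil>z\<rceil>) \<le> z + 1"
    by (simp_all add: z_def power2_eq_square)
qed

lemma approximates_output_A:
  "approximates \<epsilon> (4 / (real (length \<sigma>))\<^sup>2) (output_A f \<sigma> \<epsilon>) (diversity_index f \<sigma>)"
proof -
  let ?n = "real (length \<sigma>)"
  let ?t1 = "nat \<lceil>48 * sqrt ?n * ln ?n / \<epsilon>\<^sup>2\<rceil>" and ?t2 = "nat \<lceil>36 * sqrt ?n * ln ?n / \<epsilon>\<^sup>2\<rceil>"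
  interpret sampling_analysis f ?n "96 * ln ?n / \<epsilon>\<^sup>2" ?t1 ?t2 \<sigma> \<epsilon>
    using f \<epsilon> len array_size by unfold_locales auto
  show ?thesis
    using approximates_estimate by (subst output_A_eq) (simp_all add: array_size(1) power2_eq_square)
qed

lemma space_run_A:
  "space_at_most (run_A f \<sigma> \<epsilon>) (160 * (1 / \<epsilon>\<^sup>2 * sqrt (real (length \<sigma>)) * ln (real (length \<sigma>))))"
  unfolding space_at_most_def
proof
  let ?n = "real (length \<sigma>)"
  let ?t1 = "nat \<lceil>48 * sqrt ?n * ln ?n / \<epsilon>\<^sup>2\<rceil>" and ?t2 = "nat \<lceil>36 * sqrt ?n * ln ?n / \<epsilon>\<^sup>2\<rceil>"
  define z where "z = 1 / \<epsilon>\<^sup>2 * sqrt ?n * ln ?n"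
  interpret sampling f ?n "96 * ln ?n / \<epsilon>\<^sup>2" ?t1 ?t2 .
  fix s assume "s \<in> set_pmf (run_A f \<sigma> \<epsilon>)"
  then have dom: "dom s \<subseteq> cells ?t1 ?t2"
    by (rule dom_run_A[rotated -1]) (simp_all add: array_size(1) power2_eq_square)
  then have "finite (dom s)" using finite_cells finite_subset by blast
  have "real (card (dom s)) \<le> real (17 + ?t1 + 2 * ?t2)"
    using card_mono[OF finite_cells dom] card_cells[of ?t1 ?t2] by linarith
  \<comment> \<open>17 registers plus 3 from rounding three arrays, and 48 + 2 * 36 = 120.\<close>
  also have "\<dots> \<le> 20 + 120 * z"
  proof -
    have "real ?t1 \<le> 48 * z + 1" "real ?t2 \<le> 36 * z + 1"
      using array_size(3)[of 48] array_size(3)[of 36] by (simp_all add: z_def del: of_nat_nat)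
    then show ?thesis by simp
  qed
  \<comment> \<open>As \<open>z\<close> is at least 2/3, the constant 20 is below
    \<open>40 * z\<close>.\<close>
  also have "\<dots> \<le> 160 * z"
  proof -
    have "\<epsilon>\<^sup>2 \<le> 1" using \<epsilon> by (simp add: power_le_one)
    then have "1 \<le> 1 / \<epsilon>\<^sup>2" using \<epsilon> by simp
    moreover have "1 \<le> sqrt ?n" using len by simp
    moreover have "2 / 3 \<le> ln ?n"
      using ln2_ge_two_thirds len ln_le_cancel_iff[of 2 ?n] by linarith
    ultimately have "1 * 1 * (2 / 3) \<le> z"
      unfolding z_def by (intro mult_mono) auto
    then show ?thesis by simp
  qed
  finally show "finite (dom s) \<and> real (card (dom s)) \<le> 160 * (1 / \<epsilon>\<^sup>2 * sqrt ?n * ln ?n)"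
    using \<open>finite (dom s)\<close> by (simp only: z_def simp_thms)
qed

end

theorem theorem1:
  shows "passes algorithm_A = 3 \<and>
    (\<exists>\<delta> :: nat \<Rightarrow> real. \<delta> \<longlonglongrightarrow> 0 \<and>
       (\<forall>(f :: 'u \<Rightarrow> 'u \<Rightarrow> real) (\<sigma> :: 'u list) (\<epsilon> :: real).
          similarity f \<longrightarrow> 0 < \<epsilon> \<longrightarrow> \<epsilon> < 1 \<longrightarrow>
          approximates \<epsilon> (\<delta> (length \<sigma>)) (output_A f \<sigma> \<epsilon>) (diversity_index f \<sigma>))) \<and>
    (\<exists>C :: real.
       \<forall>(f :: 'u \<Rightarrow> 'u \<Rightarrow> real) (\<sigma> :: 'u list) (\<epsilon> :: real).
          similarity f \<longrightarrow> 0 < \<epsilon> \<longrightarrow> \<epsilon> < 1 \<longrightarrow> length \<sigma> \<ge> 2 \<longrightarrow>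
          space_at_most (run_A f \<sigma> \<epsilon>)
            (C * (1 / \<epsilon>\<^sup>2 * sqrt (real (length \<sigma>)) * ln (real (length \<sigma>)))))"
proof (intro conjI)
  show "passes algorithm_A = 3" by (simp add: passes_def algorithm_A_def)
next
  \<comment> \<open>The failure bound depends on the length alone. For fewer than two items the
    value 1 makes the claim trivial, and the limit ignores finitely many values.\<close>
  define \<delta> :: "nat \<Rightarrow> real" where "\<delta> m = (if m < 2 then 1 else 4 / (real m)\<^sup>2)" for m
  have "(\<lambda>m. 4 * (inverse (real m) * inverse (real m))) \<longlonglongrightarrow> 4 * (0 * 0)"
    by (intro tendsto_intros lim_inverse_n)
  moreover have "\<forall>\<^sub>F m in sequentially. 4 * (inverse (real m) * inverse (real m)) = \<delta> m"
    using eventually_ge_at_top[of 2]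
    by eventually_elim (auto simp: \<delta>_def power2_eq_square divide_inverse)
  ultimately have "\<delta> \<longlonglongrightarrow> 0" by (simp add: tendsto_cong)
  moreover have "approximates \<epsilon> (\<delta> (length \<sigma>)) (output_A f \<sigma> \<epsilon>) (diversity_index f \<sigma>)"
    if "similarity f" "0 < \<epsilon>" "\<epsilon> < 1" for f :: "'u \<Rightarrow> 'u \<Rightarrow> real" and \<sigma> \<epsilon>
    using approximates_output_A[OF that, of \<sigma>] by (auto simp: \<delta>_def approximates_def)
  ultimately show "\<exists>\<delta> :: nat \<Rightarrow> real. \<delta> \<longlonglongrightarrow> 0 \<and>
       (\<forall>(f :: 'u \<Rightarrow> 'u \<Rightarrow> real) (\<sigma> :: 'u list) (\<epsilon> :: real).
          similarity f \<longrightarrow> 0 < \<epsilon> \<longrightarrow> \<epsilon> < 1 \<longrightarrow>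
          approximates \<epsilon> (\<delta> (length \<sigma>)) (output_A f \<sigma> \<epsilon>) (diversity_index f \<sigma>))"
    by blast
next
  show "\<exists>C :: real.
       \<forall>(f :: 'u \<Rightarrow> 'u \<Rightarrow> real) (\<sigma> :: 'u list) (\<epsilon> :: real).
          similarity f \<longrightarrow> 0 < \<epsilon> \<longrightarrow> \<epsilon> < 1 \<longrightarrow> length \<sigma> \<ge> 2 \<longrightarrow>
          space_at_most (run_A f \<sigma> \<epsilon>)
            (C * (1 / \<epsilon>\<^sup>2 * sqrt (real (length \<sigma>)) * ln (real (length \<sigma>))))"
    using space_run_A by blast
qed

end
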